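(* For each positive integer $n$ divisible by $6$ there is a family of $2^{n/3}$ Ising Hamiltonians of the form $H_n=\sum_{k\in\mathbb{Z}_n}J_kZ_kZ_{k+1}$ with $J_k\in\{1,-1\}$ such that the following holds for all Hamiltonians in the family: (i) There is a local classical algorithm (a single one for the whole family) which achieves the approximation ratio $1$, i.e., on input $(J_k)_{k\in\mathbb{Z}_n}$ it outputs $x$ with $\langle x|H_n|x\rangle=\max_{y\in\{0,1\}^n}\langle y|H_n|y\rangle$. (ii) For every integer $p\ge1$, level-$p$ QAOA achieves an approximation ratio of at most $p/(p+1)$, i.e., $\mathsf{QAOA}_p(H_n)\le p/(p+1)$. (iii) Level-$1$ RQAOA achieves the approximation ratio $1$, i.e., its output $x$ maximizes $\langle x|H_n|x\rangle$.
   Context: Qubits are indexed by $\mathbb{Z}_n$; $Z_k$, $X_k$ are Pauli operators on qubit $k$; $|x\rangle$, $x\in\{0,1\}^n$, are the computational basis states (equivalently labelled by $z\in\{1,-1\}^n$, the eigenvalues of the $Z_k$); $|+^n\rangle=|+\rangle^{\otimes n}$. QAOA: for a diagonal Hamiltonian $H$ on $n$ qubits and $\beta,\gamma\in\mathbb{R}^p$ let $|\Psi_H(\beta,\gamma)\rangle=\prod_{m=1}^p\left(e^{i\beta_mB}e^{i\gamma_mH}\right)|+^n\rangle$, with $B=\sum_jX_j$. The approximation ratio achieved by level-$p$ QAOA is $$\mathsf{QAOA}_p(H)=\frac{\max_{\beta,\gamma\in\mathbb{R}^p}\langle\Psi_H(\beta,\gamma)|H|\Psi_H(\beta,\gamma)\rangle}{\max_{x\in\{0,1\}^n}\langle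 x|H|x\rangle}.$$ Local classical algorithm: an algorithm which on input the edge weights $(J_k)_{k\in\mathbb{Z}_n}$ (with $J_k$ the weight of edge $\{k,k+1\}$ of the cycle graph) outputs $x\in\{0,1\}^n$ is $r$-local if for every vertex $v$ there is a function $g_v$ such that, for every input, $x_v=g_v(\{J_e\}_{e\in E_r(v)})$, where $E_r(v)$ is the set of edges belonging to a path of length at most $r$ starting at $v$. It is local if it is $r$-local for a constant $r$ independent of $n$. Level-$1$ RQAOA with threshold $n_c$ ($2\le n_c<n$) for maximizing an Ising cost function $H=\sum_{(i,j)\in E}J_{i,j}Z_iZ_j$ on a graph with vertex set $V$ and edge set $E$: while the number of variables exceeds $n_c$, repeat the following. (1) Choose $(\beta^*,\gamma^* )\in\mathbb{R}^2$ maximizing $\langle\Psi_H(\beta,\gamma)|H|\Psi_H(\beta,\gamma)\rangle$ for the level-$1$ states, and compute $M_{i,j}=\langle\Psi_H(\beta^*,\gamma^* )|Z_iZ_j|\Psi_H(\beta^*,\gamma^* )\rangle$ for $(i,j)\in E$. (2) Choose $(i,j)\in E$ with the largest $|M_{i,j}|$ (ties broken arbitrarily). (3) Impose the constraint $Z_j=\mathrm{sgn}(M_{i,j})Z_i$ and substitute it into $H$ to eliminate $Z_j$: terms $Z_jZ_k$ with $k\notin\{i,j\}$ become $\mathrm{sgn}(M_{i,j})Z_iZ_k$, the term $J_{i,j}Z_iZ_j$ becomes the constant $J_{i,j}\,\mathrm{sgn}(M_{i,j})$, and other terms are unchanged; this gives a new Ising cost function in one fewer variable (plus a constant). When $n_c$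 variables remain, the remaining instance is maximized exactly by brute force, and the eliminated variables are recovered from the imposed constraints; the resulting assignment is the output.
   Formalization: Part (ii) is stated only for integers p ≥ 1 with 2p < n; for p ≥ n/2 the bound p/(p+1) is false, e.g. for n = 6, all J_k = 1, p = 3, where level-3 QAOA attains approximation ratio 1. *)

theory Defs
  imports "HOL-Analysis.Analysis"
begin

section \<open>States and operators of a finite register of qubits\<close>

text \<open>
  A register is a finite set \<open>V\<close> of qubits. A state is its amplitude function on bit strings,
  an operator a map on amplitude functions. Only the amplitudes on \<open>bitstrings V\<close> are
  meaningful; \<open>inner_prod V\<close> ignores all others.
\<close>

type_synonym 'v bits = "'v \<Rightarrow> nat"
type_synonym 'v state = "'v bits \<Rightarrow> complex"
type_synonym 'v operator = "'v state \<Rightarrow> 'v state"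

definition bitstrings :: "'v set \<Rightarrow> 'v bits set" where
  "bitstrings V = V \<rightarrow>\<^sub>E {0, 1}"

definition inner_prod :: "'v set \<Rightarrow> 'v state \<Rightarrow> 'v state \<Rightarrow> complex" where
  "inner_prod V \<phi> \<psi> = (\<Sum>x\<in>bitstrings V. cnj (\<phi> x) * \<psi> x)"

definition ket :: "'v bits \<Rightarrow> 'v state" where
  "ket x = (\<lambda>y. if y = x then 1 else 0)"

definition plus_state :: "'v set \<Rightarrow> 'v state" where
  "plus_state V = (\<lambda>x. \<Prod>k\<in>V. 1 / complex_of_real (sqrt 2))"

text \<open>The eigenvalue of \<open>Z\<^sub>k\<close> on the basis state labelled by \<open>x\<close>.\<close>

definition spin :: "'v bits \<Rightarrow> 'v \<Rightarrow> real" where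
  "spin x k = (-1) ^ x k"

definition pauliZ :: "'v \<Rightarrow> 'v operator" where
  "pauliZ k \<psi> = (\<lambda>x. of_real (spin x k) * \<psi> x)"

definition pauliX :: "'v \<Rightarrow> 'v operator" where
  "pauliX k \<psi> = (\<lambda>x. \<psi> (x(k := 1 - x k)))"

text \<open>The product of the commuting operators \<open>Z\<^sub>k\<close> for \<open>k \<in> S\<close>.\<close>

definition pauliZ_prod :: "'v set \<Rightarrow> 'v operator" where
  "pauliZ_prod S \<psi> = (\<lambda>x. of_real (\<Prod>k\<in>S. spin x k) * \<psi> x)"

lemma pauliZ_prod_edge:
  assumes "i \<noteq> j"
  shows "pauliZ_prod {i, j} = pauliZ i \<circ> pauliZ j"
  using assms by (auto simp: pauliZ_prod_def pauliZ_def fun_eq_iff)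

definition op_scale :: "complex \<Rightarrow> 'v operator \<Rightarrow> 'v operator" where
  "op_scale c A \<psi> = (\<lambda>x. c * A \<psi> x)"

definition op_exp :: "'v operator \<Rightarrow> 'v operator" where
  "op_exp A \<psi> = (\<lambda>x. \<Sum>k. (A ^^ k) \<psi> x / fact k)"

text \<open>The value \<open>\<langle>\<psi>|A|\<psi>\<rangle>\<close>; it is real for the Hermitian \<open>A\<close> considered here.\<close>

definition expval :: "'v set \<Rightarrow> 'v operator \<Rightarrow> 'v state \<Rightarrow> real" where
  "expval V A \<psi> = Re (inner_prod V \<psi> (A \<psi>))"

definition max_value :: "'v set \<Rightarrow> 'v operator \<Rightarrow> real" where
  "max_value V H = Max ((\<lambda>x. expval V H (ket x)) ` bitstrings V)"

definition is_maximizer :: "'v set \<Rightarrow> 'v operator \<Rightarrow> 'v bits \<Rightarrow> bool" where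
  "is_maximizer V H x \<longleftrightarrow> x \<in> bitstrings V \<and> expval V H (ket x) = max_value V H"


section \<open>QAOA\<close>

definition mixer :: "'v set \<Rightarrow> 'v operator" where
  "mixer V \<psi> = (\<lambda>x. \<Sum>j\<in>V. pauliX j \<psi> x)"

text \<open>
  The product over \<open>m = 1, \<dots>, p\<close> is read from left to right, so the layer \<open>m = p\<close> acts first;
  the opposite convention only renames the parameters. Of \<open>\<beta>\<close> and \<open>\<gamma>\<close> only the values at
  \<open>1, \<dots>, p\<close> are used.
\<close>

definition qaoa_state ::
  "'v set \<Rightarrow> 'v operator \<Rightarrow> nat \<Rightarrow> (nat \<Rightarrow> real) \<Rightarrow> (nat \<Rightarrow> real) \<Rightarrow> 'v state" where
  "qaoa_state V H p \<beta> \<gamma> =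
     foldr (\<lambda>m. op_exp (op_scale (\<i> * of_real (\<beta> m)) (mixer V)) \<circ>
                op_exp (op_scale (\<i> * of_real (\<gamma> m)) H))
       [1..<Suc p] (plus_state V)"

text \<open>
  The numerator is written as a supremum; the energies are bounded, and for integer weights they
  are continuous and periodic in the parameters, so that the supremum is a maximum.
\<close>

definition qaoa_ratio :: "'v set \<Rightarrow> 'v operator \<Rightarrow> nat \<Rightarrow> real" where
  "qaoa_ratio V H p =
     (SUP (\<beta>, \<gamma>). expval V H (qaoa_state V H p \<beta> \<gamma>)) / max_value V H"

abbreviation qaoa1_state :: "'v set \<Rightarrow> 'v operator \<Rightarrow> real \<Rightarrow> real \<Rightarrow> 'v state" where
  "qaoa1_state V H b g \<equiv> qaoa_state V H 1 (\<lambda>_. b) (\<lambda>_. g)"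


section \<open>Ising cost functions and level-1 RQAOA\<close>

text \<open>Edges are two-element sets of variables.\<close>

record 'v ising =
  verts :: "'v set"
  edges :: "'v set set"
  weight :: "'v set \<Rightarrow> real"
  const_term :: real

definition ising_ham :: "'v ising \<Rightarrow> 'v operator" where
  "ising_ham I \<psi> = (\<lambda>x. (\<Sum>e\<in>edges I. of_real (weight I e) * pauliZ_prod e \<psi> x)
                        + of_real (const_term I) * \<psi> x)"

text \<open>
  Substitution of \<open>Z\<^sub>j = s Z\<^sub>i\<close>: an edge \<open>{j, k}\<close> is redirected to \<open>{i, k}\<close>
  with its weight multiplied by \<open>s\<close>. It may coincide with an edge already present, in which case
  the weights add up.
\<close>

definition redirect :: "'v \<Rightarrow> 'v \<Rightarrow> 'v set \<Rightarrow> 'v set" where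
  "redirect i j e = (if j \<in> e then insert i (e - {j}) else e)"

definition eliminate :: "'v \<Rightarrow> 'v \<Rightarrow> real \<Rightarrow> 'v ising \<Rightarrow> 'v ising" where
  "eliminate i j s I =
    (let R = edges I - {{i, j}} in
     \<lparr> verts = verts I - {j},
       edges = redirect i j ` R,
       weight = (\<lambda>e'. \<Sum>e\<in>{e \<in> R. redirect i j e = e'}. (if j \<in> e then s else 1) * weight I e),
       const_term = const_term I + s * weight I {i, j} \<rparr>)"

definition qaoa1_optimal :: "'v ising \<Rightarrow> real \<Rightarrow> real \<Rightarrow> bool" where
  "qaoa1_optimal I b g \<longleftrightarrow>
     (\<forall>b' g'. expval (verts I) (ising_ham I) (qaoa1_state (verts I) (ising_ham I) b' g')
            \<le> expval (verts I) (ising_ham I) (qaoa1_state (verts I) (ising_ham I) b g))"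

definition correlation :: "'v ising \<Rightarrow> real \<Rightarrow> real \<Rightarrow> 'v \<Rightarrow> 'v \<Rightarrow> real" where
  "correlation I b g i j =
     expval (verts I) (pauliZ i \<circ> pauliZ j) (qaoa1_state (verts I) (ising_ham I) b g)"

text \<open>
  \<open>rqaoa1 n\<^sub>c I x\<close>: some run on \<open>I\<close> with threshold \<open>n\<^sub>c\<close> outputs \<open>x\<close>. The
  choices of optimal angles, of the edge among those with largest correlation, of the endpoint that
  is eliminated and of the maximizer found by brute force are all left open. If the
  chosen correlation is zero, then so is its sign, and the run has no output.
\<close>

inductive rqaoa1 :: "nat \<Rightarrow> 'v ising \<Rightarrow> 'v bits \<Rightarrow> bool" for n\<^sub>c :: nat where
  brute_force:
    "\<lbrakk> card (verts I) \<le> n\<^sub>c; is_maximizer (verts I) (ising_ham I) x \<rbrakk> \<Longrightarrow> rqaoa1 n\<^sub>c I x"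
| eliminate_step:
    "\<lbrakk> n\<^sub>c < card (verts I);
       qaoa1_optimal I b g;
       i \<noteq> j; {i, j} \<in> edges I;
       \<forall>k l. {k, l} \<in> edges I \<longrightarrow> \<bar>correlation I b g k l\<bar> \<le> \<bar>correlation I b g i j\<bar>;
       s = sgn (correlation I b g i j);
       rqaoa1 n\<^sub>c (eliminate i j s I) y;
       x \<in> bitstrings (verts I);
       restrict x (verts I - {j}) = y;
       spin x j = s * spin x i \<rbrakk> \<Longrightarrow> rqaoa1 n\<^sub>c I x"


section \<open>Ising Hamiltonians on the cycle graph\<close>

text \<open>\<open>\<int>\<^sub>n\<close> is represented by \<open>{..<n}\<close>; edge \<open>k\<close> joins \<open>k\<close> and \<open>k + 1\<close> modulo \<open>n\<close>.\<close>

definition cycle_edge :: "nat \<Rightarrow> nat \<Rightarrow> nat set" where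
  "cycle_edge n k = {k, Suc k mod n}"

definition cycle_ham :: "nat \<Rightarrow> (nat \<Rightarrow> real) \<Rightarrow> nat operator" where
  "cycle_ham n J \<psi> =
     (\<lambda>x. \<Sum>k<n. of_real (J k) * (pauliZ k \<circ> pauliZ (Suc k mod n)) \<psi> x)"

text \<open>
  Depth: a bound \<open>p / (p + 1)\<close> on \<open>qaoa_ratio\<close> for \<open>cycle_ham\<close> can only be expected for
  \<open>2 * p < n\<close>. For \<open>n = 6\<close>, \<open>J = 1\<close> and \<open>p = 3\<close> the angles
  \<open>\<beta> = (2, 7, 6) \<pi> / 8\<close>, \<open>\<gamma> = (6, 3, 2) \<pi> / 8\<close> give the ratio 1 (numerically, to machine precision).
\<close>

definition cycle_ising :: "nat \<Rightarrow> (nat \<Rightarrow> real) \<Rightarrow> nat ising" where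
  "cycle_ising n J =
     \<lparr> verts = {..<n},
       edges = cycle_edge n ` {..<n},
       weight = (\<lambda>e. \<Sum>k\<in>{k. k < n \<and> cycle_edge n k = e}. J k),
       const_term = 0 \<rparr>"

lemma ising_ham_cycle_ising:
  assumes "2 \<le> n"
  shows "ising_ham (cycle_ising n J) = cycle_ham n J"
proof (intro ext)
  fix \<psi> :: "nat state" and x :: "nat bits"
  have neq: "k \<noteq> Suc k mod n" if "k < n" for k
    using that assms by (cases "Suc k = n") auto
  have fib: "{k. k < n \<and> cycle_edge n k = e} = {k \<in> {..<n}. cycle_edge n k = e}" for e
    by auto
  have inner: "of_real (\<Sum>k\<in>{k \<in> {..<n}. cycle_edge n k = e}. J k) * pauliZ_prod e \<psi> x =
      (\<Sum>k\<in>{k \<in> {..<n}. cycle_edge n k = e}. of_real (J k) * pauliZ_prod (cycle_edge n k) \<psi> x)" for e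
    unfolding of_real_sum sum_distrib_right by (rule sum.cong) auto
  have "ising_ham (cycle_ising n J) \<psi> x =
      (\<Sum>e\<in>cycle_edge n ` {..<n}. of_real (\<Sum>k\<in>{k \<in> {..<n}. cycle_edge n k = e}. J k)
         * pauliZ_prod e \<psi> x)"
    unfolding ising_ham_def cycle_ising_def fib by simp
  also have "\<dots> = (\<Sum>e\<in>cycle_edge n ` {..<n}. \<Sum>k\<in>{k \<in> {..<n}. cycle_edge n k = e}.
         of_real (J k) * pauliZ_prod (cycle_edge n k) \<psi> x)"
    unfolding inner ..
  also have "\<dots> = (\<Sum>k<n. of_real (J k) * pauliZ_prod (cycle_edge n k) \<psi> x)"
    by (rule sum.image_gen [symmetric]) simp
  also have "\<dots> = cycle_ham n J \<psi> x"
    unfolding cycle_ham_def cycle_edge_def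
    by (rule sum.cong) (simp_all add: neq pauliZ_prod_edge)
  finally show "ising_ham (cycle_ising n J) \<psi> x = cycle_ham n J \<psi> x" .
qed


section \<open>Local classical algorithms\<close>

definition is_path :: "'v set set \<Rightarrow> 'v list \<Rightarrow> bool" where
  "is_path E vs \<longleftrightarrow> vs \<noteq> [] \<and> distinct vs \<and> (\<forall>i. Suc i < length vs \<longrightarrow> {vs ! i, vs ! Suc i} \<in> E)"

text \<open>
  \<open>E\<^sub>r(v)\<close> for the cycle graph, each edge being given by its index; a path of length at most
  \<open>r\<close> has at most \<open>r + 1\<close> vertices.
\<close>

definition local_edges :: "nat \<Rightarrow> nat \<Rightarrow> nat \<Rightarrow> nat set" where
  "local_edges n r v =
     {k. k < n \<and> (\<exists>vs i. is_path (cycle_edge n ` {..<n}) vs \<and> hd vs = v \<and> length vs \<le> Suc r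
                   \<and> Suc i < length vs \<and> cycle_edge n k = {vs ! i, vs ! Suc i})}"

definition local_algorithm :: "nat \<Rightarrow> nat \<Rightarrow> ((nat \<Rightarrow> real) \<Rightarrow> nat bits) \<Rightarrow> bool" where
  "local_algorithm n r alg \<longleftrightarrow>
     (\<forall>J \<in> {..<n} \<rightarrow>\<^sub>E UNIV. alg J \<in> bitstrings {..<n}) \<and>
     (\<forall>v<n. \<exists>g. \<forall>J \<in> {..<n} \<rightarrow>\<^sub>E UNIV. alg J v = g (restrict J (local_edges n r v)))"

end

theory Submission
  imports Defs
begin

text \<open>
  Conjugating a diagonal observable by one QAOA layer enlarges its support by one site on each side.
  After \<open>p\<close> layers the energy of an edge of the cycle therefore depends only on the \<open>2 p + 1\<close> edges
  around it, which may be closed up to a frustrated ring on \<open>2 p + 2\<close> vertices. There a twisted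
  translation makes all edges equivalent, and one edge is always violated, so each contributes at
  most \<open>2 p / (2 p + 2)\<close>.

  For RQAOA the same symmetry shows that at the optimal angles all edges of an unfrustrated ring
  have the same mean energy. It is positive because the optimal level-1 energy exceeds the mean of
  the Hamiltonian, so every correlation has the sign of its coupling. Eliminating a variable then
  gives an unfrustrated ring again.
\<close>

section \<open>Amplitudes of QAOA states\<close>

text \<open>The exponentials are pointwise series, so they are first turned into finite sums: the
  phase operator is diagonal, and the mixer is diagonalised by Walsh characters. From then on a
  Hamiltonian enters only through its energy function \<open>h\<close>, and a conjugated observable
  only through phase differences \<open>h y - h x\<close>. Two Hamiltonians whose differences agree
  inside a light cone are therefore interchangeable, even if their graphs differ; so the cycle may
  be exchanged for a shorter ring on the same register, the remaining qubits becoming spectators.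

  The closing edge must make that ring frustrated: for the unfrustrated couplings of the family the
  symmetry alone gives only the trivial bound 1. Closing needs \<open>2 * p + 2 \<le> n\<close>,
  which follows from \<open>2 * p < n\<close> because n is even. Divisibility by 3 serves the
  family: free spins at distance 3 give \<open>2 ^ (n div 3)\<close> distinct instances whose
  optimum can be read off locally.

  For RQAOA the strict positivity matters, since a run with a zero correlation would have no
  output.\<close>

definition flip :: "'v \<Rightarrow> 'v bits \<Rightarrow> 'v bits" where
  "flip k x = x(k := 1 - x k)"

lemma finite_bitstrings [simp, intro]: "finite V \<Longrightarrow> finite (bitstrings V)"
  unfolding bitstrings_def by (intro finite_PiE) auto

lemma bitstrings_cases: "x \<in> bitstrings V \<Longrightarrow> k \<in> V \<Longrightarrow> x k = 0 \<or> x k = 1"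
  unfolding bitstrings_def by (auto dest!: PiE_mem)

lemma bitstrings_eqI:
  "x \<in> bitstrings V \<Longrightarrow> y \<in> bitstrings V \<Longrightarrow> (\<And>k. k \<in> V \<Longrightarrow> x k = y k) \<Longrightarrow> x = y"
  unfolding bitstrings_def by (rule PiE_ext)

lemma flip_bitstrings [simp]: "x \<in> bitstrings V \<Longrightarrow> k \<in> V \<Longrightarrow> flip k x \<in> bitstrings V"
  unfolding bitstrings_def flip_def by (auto simp: PiE_iff extensional_def)

text \<open>The truncated \<open>1 - x k\<close> is an involution on bit values only, hence the
  membership hypotheses here and in \<open>spin_flip\<close>.\<close>

lemma flip_flip: "x \<in> bitstrings V \<Longrightarrow> k \<in> V \<Longrightarrow> flip k (flip k x) = x"
  using bitstrings_cases[of x V k] by (auto simp: flip_def fun_eq_iff)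

lemma sum_flip:
  assumes "k \<in> V"
  shows "(\<Sum>x\<in>bitstrings V. f (flip k x)) = (\<Sum>x\<in>bitstrings V. f x)"
  by (rule sum.reindex_bij_witness[of _ "flip k" "flip k"])
    (use assms in \<open>auto simp: flip_flip\<close>)

lemma spin_flip:
  "x \<in> bitstrings V \<Longrightarrow> k \<in> V \<Longrightarrow> spin (flip k x) j = (if j = k then - spin x j else spin x j)"
  using bitstrings_cases[of x V k] by (auto simp: spin_def flip_def)

lemma spin_cases: "spin x k = 1 \<or> spin x k = -1"
  unfolding spin_def by (cases "even (x k)") auto

lemma spin_mult_self [simp]: "spin x k * spin x k = 1"
  using spin_cases[of x k] by auto

lemma spin_mult_eq:
  "x \<in> bitstrings V \<Longrightarrow> y \<in> bitstrings V \<Longrightarrow> k \<in> V \<Longrightarrow>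
    spin x k * spin y k = (if x k = y k then 1 else -1)"
  using bitstrings_cases[of x V k] bitstrings_cases[of y V k] by (auto simp: spin_def)

definition diag_op :: "('v bits \<Rightarrow> real) \<Rightarrow> 'v operator" where
  "diag_op h \<psi> = (\<lambda>x. of_real (h x) * \<psi> x)"

text \<open>Matrix elements of \<open>exp (\<i> * b * B)\<close>: the X on different qubits commute,
  so the exponential is a tensor product of the one-qubit matrices cos b + i X sin b.\<close>

definition mixer_kernel :: "'v set \<Rightarrow> real \<Rightarrow> 'v bits \<Rightarrow> 'v bits \<Rightarrow> complex" where
  "mixer_kernel V b x y =
     (\<Prod>k\<in>V. if x k = y k then of_real (cos b) else \<i> * of_real (sin b))"

section \<open>Matrix elements of the two exponentials in a layer\<close>

lemma op_exp_diag_op: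
  "op_exp (op_scale (\<i> * of_real g) (diag_op h)) \<psi> x = exp (\<i> * of_real (g * h x)) * \<psi> x"
proof -
  have "(op_scale (\<i> * of_real g) (diag_op h) ^^ k) \<psi> x = (\<i> * of_real (g * h x)) ^ k * \<psi> x" for k
    by (induction k) (simp_all add: op_scale_def diag_op_def)
  moreover have "(\<lambda>k. (\<i> * of_real (g * h x)) ^ k * \<psi> x / fact k) sums (exp (\<i> * of_real (g * h x)) * \<psi> x)"
    using sums_mult2[OF exp_converges[of "\<i> * complex_of_real (g * h x)"], of "\<psi> x"]
    by (simp add: scaleR_conv_of_real divide_inverse mult_ac)
  ultimately show ?thesis
    unfolding op_exp_def by (simp add: sums_iff)
qed

text \<open>2 cos b and 2 i sin b are the sum and the difference of exp (i b) and exp (- i b). When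
  the product of these is expanded, S collects the sites where exp (- i b) is chosen, and the
  product of the two spins at a site tells the sum from the difference.\<close>

lemma mixer_kernel_walsh:
  assumes V: "finite V" and x: "x \<in> bitstrings V" and y: "y \<in> bitstrings V"
  shows "(\<Sum>S\<in>Pow V. of_real (\<Prod>k\<in>S. spin x k * spin y k) *
            exp (\<i> * of_real b * of_int (int (card V) - 2 * int (card S)))) =
         2 ^ card V * mixer_kernel V b x y"
proof -
  let ?f = "\<lambda>k. complex_of_real (spin x k * spin y k) * exp (- (\<i> * of_real b))"
  let ?g = "\<lambda>k::'a. exp (\<i> * of_real b)"
  have "2 ^ card V * mixer_kernel V b x y =
      (\<Prod>k\<in>V. 2 * (if x k = y k then of_real (cos b) else \<i> * of_real (sin b)))"
    unfolding mixer_kernel_def by (simp add: prod.distrib)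
  also have "\<dots> = (\<Prod>k\<in>V. ?f k + ?g k)"
  proof (rule prod.cong)
    fix k assume "k \<in> V"
    have "complex_of_real (cos b) = cos (of_real b)" "complex_of_real (sin b) = sin (of_real b)"
      by (simp_all add: cos_of_real sin_of_real)
    then show "2 * (if x k = y k then of_real (cos b) else \<i> * of_real (sin b)) = ?f k + ?g k"
      unfolding spin_mult_eq[OF x y \<open>k \<in> V\<close>]
      by (simp add: cos_exp_eq sin_exp_eq field_simps)
  qed simp
  also have "\<dots> = (\<Sum>S\<in>Pow V. (\<Prod>k\<in>S. ?f k) * (\<Prod>k\<in>V - S. ?g k))"
    by (rule prod_add[OF V])
  also have "\<dots> = (\<Sum>S\<in>Pow V. of_real (\<Prod>k\<in>S. spin x k * spin y k) *
            exp (\<i> * of_real b * of_int (int (card V) - 2 * int (card S))))"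
  proof (rule sum.cong)
    fix S assume "S \<in> Pow V"
    then have S: "S \<subseteq> V" "finite S" and c: "card (V - S) = card V - card S" "card S \<le> card V"
      using V by (auto intro: finite_subset card_Diff_subset card_mono)
    have "exp (- (\<i> * complex_of_real b)) ^ card S * exp (\<i> * of_real b) ^ (card V - card S) =
        exp (\<i> * of_real b * of_int (int (card V) - 2 * int (card S)))"
      unfolding exp_of_nat_mult[symmetric] exp_add[symmetric] using c
      by (intro arg_cong[where f = exp]) (simp add: of_nat_diff algebra_simps)
    then show "(\<Prod>k\<in>S. ?f k) * (\<Prod>k\<in>V - S. ?g k) = of_real (\<Prod>k\<in>S. spin x k * spin y k) *
            exp (\<i> * of_real b * of_int (int (card V) - 2 * int (card S)))"
      using c by (simp add: prod.distrib)
  qed simp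
  finally show ?thesis ..
qed

lemma mixer_kernel_0:
  assumes "finite V" "x \<in> bitstrings V" "y \<in> bitstrings V"
  shows "mixer_kernel V 0 x y = (if x = y then 1 else 0)"
  using assms bitstrings_eqI[of x V y] by (auto simp: mixer_kernel_def)

text \<open>Walsh characters are eigenvectors of the mixer because a flip at j changes the sign of
  the character of S exactly when j lies in S.\<close>

lemma mixer_walsh:
  assumes "finite V" "x \<in> bitstrings V" "S \<subseteq> V"
  shows "(\<Sum>j\<in>V. \<Prod>k\<in>S. spin (flip j x) k) =
    of_int (int (card V) - 2 * int (card S)) * (\<Prod>k\<in>S. spin x k)"
proof -
  have *: "(\<Prod>k\<in>S. spin (flip j x) k) = (if j \<in> S then -1 else 1) * (\<Prod>k\<in>S. spin x k)" if "j \<in> V" for j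
  proof -
    have fS: "finite S" using assms finite_subset by blast
    have "(\<Prod>k\<in>S. spin (flip j x) k) = (\<Prod>k\<in>S. (if k = j then -1 else 1) * spin x k)"
      by (rule prod.cong) (simp_all add: spin_flip[OF assms(2) that])
    also have "\<dots> = (if j \<in> S then -1 else 1) * (\<Prod>k\<in>S. spin x k)"
      using fS by (simp add: prod.distrib prod.delta)
    finally show ?thesis .
  qed
  have "(\<Sum>j\<in>V. \<Prod>k\<in>S. spin (flip j x) k) = (\<Sum>j\<in>V. if j \<in> S then -1 else 1) * (\<Prod>k\<in>S. spin x k)"
    unfolding sum_distrib_right by (rule sum.cong) (simp_all add: *)
  also have "(\<Sum>j\<in>V. if j \<in> S then -1 else 1) = (\<Sum>j\<in>V. 1 - 2 * (if j \<in> S then 1 else 0::real))"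
    by (rule sum.cong) auto
  also have "\<dots> = of_int (int (card V) - 2 * int (card S))"
    using assms by (simp add: sum_subtractf sum_distrib_left[symmetric] sum.If_cases Int_absorb1)
  finally show ?thesis .
qed

text \<open>Spectral decomposition of the powers, the form in which the series of
  \<open>op_exp\<close> can be summed. The factor \<open>2 ^ card V\<close> is the squared norm of a
  character.\<close>

lemma mixer_power:
  assumes V: "finite V" and x: "x \<in> bitstrings V"
  shows "2 ^ card V * (op_scale (\<i> * of_real b) (mixer V) ^^ m) \<psi> x =
    (\<Sum>y\<in>bitstrings V. \<Sum>S\<in>Pow V. of_real (\<Prod>k\<in>S. spin x k * spin y k) *
       (\<i> * of_real b * of_int (int (card V) - 2 * int (card S))) ^ m * \<psi> y)"
  using x
proof (induction m arbitrary: x)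
  case 0
  \<comment> \<open>Completeness of the characters is \<open>mixer_kernel_walsh\<close> at angle 0,
    where the kernel is the identity.\<close>
  have "(\<Sum>y\<in>bitstrings V. \<Sum>S\<in>Pow V. of_real (\<Prod>k\<in>S. spin x k * spin y k) * \<psi> y)
      = (\<Sum>y\<in>bitstrings V. 2 ^ card V * mixer_kernel V 0 x y * \<psi> y)"
    using mixer_kernel_walsh[OF V 0, of _ 0]
    by (intro sum.cong) (simp_all add: sum_distrib_right[symmetric])
  also have "\<dots> = (\<Sum>y\<in>bitstrings V. if y = x then 2 ^ card V * \<psi> y else 0)"
    by (rule sum.cong) (auto simp: mixer_kernel_0[OF V 0])
  also have "\<dots> = 2 ^ card V * \<psi> x"
    using V 0 by simp
  finally show ?case by simp
next
  case (Suc m)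
  let ?A = "op_scale (\<i> * of_real b) (mixer V)"
  let ?e = "\<lambda>S. of_int (int (card V) - 2 * int (card S)) :: complex"
  have "2 ^ card V * (?A ^^ Suc m) \<psi> x =
      \<i> * of_real b * (\<Sum>j\<in>V. 2 ^ card V * (?A ^^ m) \<psi> (flip j x))"
    by (simp add: op_scale_def mixer_def pauliX_def flip_def sum_distrib_left algebra_simps)
  also have "(\<Sum>j\<in>V. 2 ^ card V * (?A ^^ m) \<psi> (flip j x)) =
     (\<Sum>j\<in>V. \<Sum>y\<in>bitstrings V. \<Sum>S\<in>Pow V. of_real (\<Prod>k\<in>S. spin (flip j x) k * spin y k) *
       (\<i> * of_real b * ?e S) ^ m * \<psi> y)"
    by (rule sum.cong) (simp_all add: Suc.IH[OF flip_bitstrings[OF Suc.prems]])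
  also have "\<dots> = (\<Sum>y\<in>bitstrings V. \<Sum>S\<in>Pow V. \<Sum>j\<in>V. of_real (\<Prod>k\<in>S. spin (flip j x) k * spin y k) *
       (\<i> * of_real b * ?e S) ^ m * \<psi> y)"
    by (subst sum.swap) (simp add: sum.swap[of _ V])
  also have "\<i> * of_real b * \<dots> = (\<Sum>y\<in>bitstrings V. \<Sum>S\<in>Pow V. of_real (\<Prod>k\<in>S. spin x k * spin y k) *
       (\<i> * of_real b * ?e S) ^ Suc m * \<psi> y)"
  proof -
    have "\<i> * of_real b * (\<Sum>j\<in>V. of_real (\<Prod>k\<in>S. spin (flip j x) k * spin y k) *
       (\<i> * of_real b * ?e S) ^ m * \<psi> y) =
       of_real (\<Prod>k\<in>S. spin x k * spin y k) * (\<i> * of_real b * ?e S) ^ Suc m * \<psi> y"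
      if "S \<in> Pow V" for S y
    proof -
      define P where "P j = complex_of_real (\<Prod>k\<in>S. spin (flip j x) k)" for j
      define Q where "Q = complex_of_real (\<Prod>k\<in>S. spin y k)"
      define R where "R = (\<i> * of_real b * ?e S) ^ m * \<psi> y"
      have "(\<Sum>j\<in>V. P j * Q * R) = (\<Sum>j\<in>V. P j) * Q * R"
        by (simp only: sum_distrib_right)
      also have "(\<Sum>j\<in>V. P j) = ?e S * of_real (\<Prod>k\<in>S. spin x k)"
        using arg_cong[OF mixer_walsh[OF V Suc.prems, of S], of complex_of_real] that
        by (simp add: P_def)
      finally have "\<i> * of_real b * (\<Sum>j\<in>V. P j * Q * R) =
          of_real (\<Prod>k\<in>S. spin x k) * Q * (\<i> * of_real b * ?e S) * R"
        by (simp only: mult_ac)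
      then show ?thesis
        by (simp only: P_def Q_def R_def prod.distrib of_real_mult power_Suc mult_ac)
    qed
    then show ?thesis
      unfolding sum_distrib_left by (intro sum.cong refl) (simp_all add: sum_distrib_left)
  qed
  finally show ?case .
qed

text \<open>By the spectral decomposition the series is a finite combination of scalar exponential
  series.\<close>

lemma op_exp_mixer:
  assumes V: "finite V" and x: "x \<in> bitstrings V"
  shows "op_exp (op_scale (\<i> * of_real b) (mixer V)) \<psi> x =
    (\<Sum>y\<in>bitstrings V. mixer_kernel V b x y * \<psi> y)"
proof -
  let ?E = "\<lambda>S. \<i> * of_real b * of_int (int (card V) - 2 * int (card S)) :: complex"
  let ?P = "\<lambda>S y. complex_of_real (\<Prod>k\<in>S. spin x k * spin y k)"
  let ?A = "op_scale (\<i> * of_real b) (mixer V)"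
  have "(\<lambda>m. \<Sum>y\<in>bitstrings V. \<Sum>S\<in>Pow V. ?P S y * (?E S ^ m /\<^sub>R fact m) * \<psi> y) sums
      (\<Sum>y\<in>bitstrings V. \<Sum>S\<in>Pow V. ?P S y * exp (?E S) * \<psi> y)"
    by (intro sums_sum sums_mult sums_mult2 exp_converges)
  also have "(\<lambda>m. \<Sum>y\<in>bitstrings V. \<Sum>S\<in>Pow V. ?P S y * (?E S ^ m /\<^sub>R fact m) * \<psi> y) =
      (\<lambda>m. 2 ^ card V * ((?A ^^ m) \<psi> x / fact m))"
  proof
    fix m
    have "2 ^ card V * ((?A ^^ m) \<psi> x / fact m) = (2 ^ card V * (?A ^^ m) \<psi> x) * (1 / fact m)"
      by simp
    also have "\<dots> = (\<Sum>y\<in>bitstrings V. \<Sum>S\<in>Pow V. ?P S y * ?E S ^ m * \<psi> y * (1 / fact m))"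
      unfolding mixer_power[OF V x] by (simp only: sum_distrib_right)
    finally show "(\<Sum>y\<in>bitstrings V. \<Sum>S\<in>Pow V. ?P S y * (?E S ^ m /\<^sub>R fact m) * \<psi> y) =
        2 ^ card V * ((?A ^^ m) \<psi> x / fact m)"
      by (simp add: scaleR_conv_of_real divide_inverse mult_ac)
  qed
  also have "(\<Sum>y\<in>bitstrings V. \<Sum>S\<in>Pow V. ?P S y * exp (?E S) * \<psi> y) =
      2 ^ card V * (\<Sum>y\<in>bitstrings V. mixer_kernel V b x y * \<psi> y)"
    unfolding sum_distrib_left
    using mixer_kernel_walsh[OF V x, of _ b]
    by (intro sum.cong) (simp_all only: sum_distrib_right[symmetric] mult.assoc[symmetric])
  finally have "(\<lambda>m. (?A ^^ m) \<psi> x / fact m) sums (\<Sum>y\<in>bitstrings V. mixer_kernel V b x y * \<psi> y)"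
    by (subst (asm) sums_mult_iff) auto
  then show ?thesis
    unfolding op_exp_def by (simp add: sums_iff)
qed

section \<open>QAOA amplitudes and means as finite sums\<close>

definition qaoa_layer ::
  "'v set \<Rightarrow> ('v bits \<Rightarrow> real) \<Rightarrow> real \<Rightarrow> real \<Rightarrow> 'v state \<Rightarrow> 'v state" where
  "qaoa_layer V h b g \<psi> x =
     (\<Sum>y\<in>bitstrings V. mixer_kernel V b x y * (exp (\<i> * of_real (g * h y)) * \<psi> y))"

text \<open>The layers form a list, head outermost, so that an induction peels off one layer at a
  time. In \<open>qaoa_mean\<close> the energy function \<open>h\<close> is kept apart from the
  observable, since \<open>h\<close> will be replaced under a fixed observable.\<close>

definition qaoa_amp ::
  "'v set \<Rightarrow> ('v bits \<Rightarrow> real) \<Rightarrow> (nat \<Rightarrow> real) \<Rightarrow> (nat \<Rightarrow> real) \<Rightarrow> nat list \<Rightarrow> 'v state" where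
  "qaoa_amp V h \<beta> \<gamma> ms = foldr (\<lambda>m. qaoa_layer V h (\<beta> m) (\<gamma> m)) ms (plus_state V)"

definition qaoa_mean ::
  "'v set \<Rightarrow> ('v bits \<Rightarrow> real) \<Rightarrow> (nat \<Rightarrow> real) \<Rightarrow> (nat \<Rightarrow> real) \<Rightarrow> nat list \<Rightarrow>
   ('v bits \<Rightarrow> real) \<Rightarrow> real" where
  "qaoa_mean V h \<beta> \<gamma> ms f = (\<Sum>x\<in>bitstrings V. (cmod (qaoa_amp V h \<beta> \<gamma> ms x))\<^sup>2 * f x)"

lemma qaoa_amp_Nil [simp]: "qaoa_amp V h \<beta> \<gamma> [] = plus_state V"
  by (simp add: qaoa_amp_def)

lemma qaoa_amp_Cons [simp]:
  "qaoa_amp V h \<beta> \<gamma> (m # ms) = qaoa_layer V h (\<beta> m) (\<gamma> m) (qaoa_amp V h \<beta> \<gamma> ms)"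
  by (simp add: qaoa_amp_def)

lemma qaoa_state_eq_amp:
  assumes V: "finite V" and x: "x \<in> bitstrings V"
  shows "qaoa_state V (diag_op h) p \<beta> \<gamma> x = qaoa_amp V h \<beta> \<gamma> [1..<Suc p] x"
proof -
  have "foldr (\<lambda>m. op_exp (op_scale (\<i> * of_real (\<beta> m)) (mixer V)) \<circ>
                op_exp (op_scale (\<i> * of_real (\<gamma> m)) (diag_op h))) ms (plus_state V) x =
      qaoa_amp V h \<beta> \<gamma> ms x" for ms
    using x
  proof (induction ms arbitrary: x)
    case (Cons m ms)
    then show ?case
      by (simp add: op_exp_mixer[OF V] op_exp_diag_op qaoa_layer_def)
  qed simp
  then show ?thesis unfolding qaoa_state_def .
qed

lemma expval_diag_op:
  "expval V (diag_op f) \<psi> = (\<Sum>x\<in>bitstrings V. (cmod (\<psi> x))\<^sup>2 * f x)"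
proof -
  have "Re (cnj (\<psi> x) * (of_real (f x) * \<psi> x)) = (cmod (\<psi> x))\<^sup>2 * f x" for x
    by (simp add: cmod_def power2_eq_square algebra_simps)
  then show ?thesis
    unfolding expval_def inner_prod_def diag_op_def Re_sum by simp
qed

lemma expval_qaoa_state:
  assumes "finite V"
  shows "expval V (diag_op f) (qaoa_state V (diag_op h) p \<beta> \<gamma>) = qaoa_mean V h \<beta> \<gamma> [1..<Suc p] f"
  unfolding expval_diag_op qaoa_mean_def
  by (rule sum.cong) (simp_all only: qaoa_state_eq_amp[OF assms])

lemma expval_ket:
  assumes "finite V" "x \<in> bitstrings V"
  shows "expval V (diag_op h) (ket x) = h x"
  using assms unfolding expval_diag_op ket_def
  by (simp add: if_distrib[of "\<lambda>c. (cmod c)\<^sup>2 * _"] cong: if_cong)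

section \<open>Heisenberg evolution of kernels\<close>

definition kernel_form :: "'v set \<Rightarrow> ('v bits \<Rightarrow> 'v bits \<Rightarrow> complex) \<Rightarrow> 'v state \<Rightarrow> complex" where
  "kernel_form V A \<psi> = (\<Sum>x\<in>bitstrings V. \<Sum>y\<in>bitstrings V. cnj (\<psi> x) * A x y * \<psi> y)"

definition mixer_conj ::
  "'v set \<Rightarrow> real \<Rightarrow> ('v bits \<Rightarrow> 'v bits \<Rightarrow> complex) \<Rightarrow> 'v bits \<Rightarrow> 'v bits \<Rightarrow> complex" where
  "mixer_conj V b A x y = (\<Sum>u\<in>bitstrings V. \<Sum>v\<in>bitstrings V.
     cnj (mixer_kernel V b u x) * A u v * mixer_kernel V b v y)"

text \<open>The observable after one layer in the Heisenberg picture. The layer applies its phases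
  first, so the conjugation ends with them, and \<open>h\<close> enters only through
  \<open>h y - h x\<close>; locality rests on this.\<close>

definition layer_conj ::
  "'v set \<Rightarrow> ('v bits \<Rightarrow> real) \<Rightarrow> real \<Rightarrow> real \<Rightarrow> ('v bits \<Rightarrow> 'v bits \<Rightarrow> complex) \<Rightarrow>
   'v bits \<Rightarrow> 'v bits \<Rightarrow> complex" where
  "layer_conj V h b g A x y = exp (\<i> * of_real (g * (h y - h x))) * mixer_conj V b A x y"

text \<open>Moves the outermost layer from the state to the observable; the four sums over bit
  strings are merely reordered.\<close>

lemma kernel_form_layer:
  "kernel_form V A (qaoa_layer V h b g \<psi>) = kernel_form V (layer_conj V h b g A) \<psi>"
proof -
  let ?B = "bitstrings V" and ?K = "mixer_kernel V b"
  define \<phi> where "\<phi> x = exp (\<i> * of_real (g * h x)) * \<psi> x" for x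
  have "kernel_form V A (qaoa_layer V h b g \<psi>) =
      (\<Sum>u\<in>?B. \<Sum>v\<in>?B. \<Sum>x\<in>?B. \<Sum>y\<in>?B. cnj (\<phi> x) * (cnj (?K u x) * A u v * ?K v y) * \<phi> y)"
    unfolding kernel_form_def
  proof (intro sum.cong refl)
    fix u v
    have "cnj (qaoa_layer V h b g \<psi> u) * A u v * qaoa_layer V h b g \<psi> v =
        A u v * ((\<Sum>x\<in>?B. cnj (?K u x * \<phi> x)) * (\<Sum>y\<in>?B. ?K v y * \<phi> y))"
      unfolding qaoa_layer_def \<phi>_def[symmetric] cnj_sum by (simp only: mult_ac)
    also have "\<dots> = (\<Sum>x\<in>?B. \<Sum>y\<in>?B. A u v * (cnj (?K u x * \<phi> x) * (?K v y * \<phi> y)))"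
      by (subst sum_product) (simp only: sum_distrib_left)
    finally show "cnj (qaoa_layer V h b g \<psi> u) * A u v * qaoa_layer V h b g \<psi> v =
        (\<Sum>x\<in>?B. \<Sum>y\<in>?B. cnj (\<phi> x) * (cnj (?K u x) * A u v * ?K v y) * \<phi> y)"
      by (simp only: complex_cnj_mult mult_ac)
  qed
  also have "\<dots> = (\<Sum>u\<in>?B. \<Sum>x\<in>?B. \<Sum>v\<in>?B. \<Sum>y\<in>?B. cnj (\<phi> x) * (cnj (?K u x) * A u v * ?K v y) * \<phi> y)"
    by (rule sum.cong[OF refl], rule sum.swap)
  also have "\<dots> = (\<Sum>x\<in>?B. \<Sum>u\<in>?B. \<Sum>v\<in>?B. \<Sum>y\<in>?B. cnj (\<phi> x) * (cnj (?K u x) * A u v * ?K v y) * \<phi> y)"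
    by (rule sum.swap)
  also have "\<dots> = (\<Sum>x\<in>?B. \<Sum>u\<in>?B. \<Sum>y\<in>?B. \<Sum>v\<in>?B. cnj (\<phi> x) * (cnj (?K u x) * A u v * ?K v y) * \<phi> y)"
    by (rule sum.cong[OF refl], rule sum.cong[OF refl], rule sum.swap)
  also have "\<dots> = (\<Sum>x\<in>?B. \<Sum>y\<in>?B. \<Sum>u\<in>?B. \<Sum>v\<in>?B. cnj (\<phi> x) * (cnj (?K u x) * A u v * ?K v y) * \<phi> y)"
    by (rule sum.cong[OF refl], rule sum.swap)
  also have "\<dots> = (\<Sum>x\<in>?B. \<Sum>y\<in>?B. cnj (\<phi> x) * mixer_conj V b A x y * \<phi> y)"
    unfolding mixer_conj_def by (simp only: sum_distrib_left sum_distrib_right)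
  also have "\<dots> = kernel_form V (layer_conj V h b g A) \<psi>"
    unfolding kernel_form_def
  proof (intro sum.cong refl)
    fix x y
    let ?M = "mixer_conj V b A x y"
    have "cnj (exp (\<i> * complex_of_real (g * h x))) * exp (\<i> * of_real (g * h y)) =
        exp (\<i> * of_real (g * (h y - h x)))"
      unfolding exp_cnj exp_add[symmetric] by (simp add: algebra_simps)
    moreover have "cnj (\<phi> x) * ?M * \<phi> y =
        cnj (exp (\<i> * complex_of_real (g * h x))) * exp (\<i> * of_real (g * h y)) * (cnj (\<psi> x) * ?M * \<psi> y)"
      by (simp only: \<phi>_def complex_cnj_mult mult_ac)
    ultimately show "cnj (\<phi> x) * ?M * \<phi> y = cnj (\<psi> x) * layer_conj V h b g A x y * \<psi> y"
      by (simp only: layer_conj_def mult_ac)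
  qed
  finally show ?thesis .
qed

section \<open>Means of diagonal observables and conservation of the norm\<close>

lemma qaoa_mean_eq_kernel_form:
  assumes "finite V"
  shows "of_real (qaoa_mean V h \<beta> \<gamma> ms f) =
    kernel_form V (\<lambda>x y. if x = y then of_real (f x) else 0) (qaoa_amp V h \<beta> \<gamma> ms)"
proof -
  have "(\<Sum>y\<in>bitstrings V. cnj (\<psi> x) * (if x = y then of_real (f x) else 0) * \<psi> y) =
      of_real ((cmod (\<psi> x))\<^sup>2 * f x)" if "x \<in> bitstrings V" for \<psi> :: "'a state" and x
  proof -
    have "(\<Sum>y\<in>bitstrings V. cnj (\<psi> x) * (if x = y then of_real (f x) else 0) * \<psi> y) =
        (\<Sum>y\<in>bitstrings V. if y = x then cnj (\<psi> x) * of_real (f x) * \<psi> x else 0)"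
      by (rule sum.cong) auto
    also have "\<dots> = cnj (\<psi> x) * of_real (f x) * \<psi> x"
      using assms that by simp
    finally show ?thesis
      using complex_norm_square[of "\<psi> x"] by (simp add: mult_ac)
  qed
  then show ?thesis
    unfolding qaoa_mean_def kernel_form_def of_real_sum by (intro sum.cong) auto
qed

text \<open>The sum over bit strings factors over the sites, so unitarity of the mixer reduces to
  that of a 2 by 2 matrix.\<close>

lemma mixer_conj_id:
  assumes V: "finite V" and x: "x \<in> bitstrings V" and y: "y \<in> bitstrings V"
  shows "mixer_conj V b (\<lambda>u v. if u = v then 1 else 0) x y = (if x = y then 1 else 0)"
proof -
  let ?c = "\<lambda>a a'::nat. if a = a' then complex_of_real (cos b) else \<i> * of_real (sin b)"
  have "mixer_conj V b (\<lambda>u v. if u = v then 1 else 0) x y =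
      (\<Sum>u\<in>bitstrings V. \<Sum>v\<in>bitstrings V. if v = u then cnj (mixer_kernel V b u x) * mixer_kernel V b u y else 0)"
    unfolding mixer_conj_def by (intro sum.cong) auto
  also have "\<dots> = (\<Sum>u\<in>bitstrings V. \<Prod>k\<in>V. cnj (?c (u k) (x k)) * ?c (u k) (y k))"
    using V by (intro sum.cong) (simp_all add: mixer_kernel_def prod.distrib)
  also have "\<dots> = (\<Prod>k\<in>V. \<Sum>a\<in>{0, 1}. cnj (?c a (x k)) * ?c a (y k))"
    unfolding bitstrings_def by (rule prod_sum_PiE[symmetric]) (use V in auto)
  also have "\<dots> = (\<Prod>k\<in>V. if x k = y k then 1 else 0)"
  proof (rule prod.cong)
    fix k assume k: "k \<in> V"
    have "complex_of_real (cos b) * of_real (cos b) + of_real (sin b) * of_real (sin b) = 1"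
      unfolding of_real_mult[symmetric] of_real_add[symmetric] using sin_cos_squared_add[of b]
      by (simp add: power2_eq_square add.commute)
    then show "(\<Sum>a\<in>{0, 1}. cnj (?c a (x k)) * ?c a (y k)) = (if x k = y k then 1 else 0)"
      using bitstrings_cases[OF x k] bitstrings_cases[OF y k]
      by (elim disjE) (simp_all add: algebra_simps)
  qed simp
  also have "\<dots> = (if x = y then 1 else 0)"
    using V bitstrings_eqI[OF x y] by auto
  finally show ?thesis .
qed

lemma card_bitstrings: "finite V \<Longrightarrow> card (bitstrings V) = 2 ^ card V"
  unfolding bitstrings_def by (simp add: card_PiE numeral_2_eq_2)

lemma cmod_plus_state: "(cmod (plus_state V x))\<^sup>2 = 1 / 2 ^ card V"
proof -
  have "(cmod (plus_state V x))\<^sup>2 = ((1 / sqrt 2)\<^sup>2) ^ card V"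
    unfolding plus_state_def prod_constant norm_power norm_divide
    by (simp only: norm_one norm_of_real power_commutes flip: power_mult) (simp add: mult.commute)
  then show ?thesis by (simp add: power_divide)
qed

text \<open>Norm conservation in the Heisenberg picture: every layer fixes the identity kernel,
  since the phases cancel on the diagonal, and the plus state is normalised.\<close>

lemma qaoa_mean_one:
  assumes V: "finite V"
  shows "qaoa_mean V h \<beta> \<gamma> ms (\<lambda>_. 1) = 1"
proof -
  let ?I = "\<lambda>x y::'a bits. if x = y then 1 else 0 :: complex"
  have "kernel_form V ?I (qaoa_amp V h \<beta> \<gamma> ms) = 1"
  proof (induction ms)
    case Nil
    have "kernel_form V ?I (plus_state V) = of_real (qaoa_mean V h \<beta> \<gamma> [] (\<lambda>_. 1))"
      using qaoa_mean_eq_kernel_form[OF V, of h \<beta> \<gamma> "[]" "\<lambda>_. 1"]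
      unfolding of_real_1 by simp
    also have "\<dots> = 1"
      unfolding qaoa_mean_def using V by (simp add: cmod_plus_state card_bitstrings)
    finally show ?case by simp
  next
    case (Cons m ms)
    have "kernel_form V (layer_conj V h (\<beta> m) (\<gamma> m) ?I) \<psi> = kernel_form V ?I \<psi>" for \<psi>
      unfolding kernel_form_def
      by (intro sum.cong refl) (simp add: layer_conj_def mixer_conj_id[OF V])
    then show ?case using Cons by (simp add: kernel_form_layer)
  qed
  then show ?thesis
    using qaoa_mean_eq_kernel_form[OF V, of h \<beta> \<gamma> ms "\<lambda>_. 1"]
    unfolding of_real_1 by simp
qed

lemma qaoa_mean_le:
  assumes "finite V" "\<And>x. x \<in> bitstrings V \<Longrightarrow> f x \<le> B"
  shows "qaoa_mean V h \<beta> \<gamma> ms f \<le> B"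
proof -
  have "qaoa_mean V h \<beta> \<gamma> ms f \<le> (\<Sum>x\<in>bitstrings V. (cmod (qaoa_amp V h \<beta> \<gamma> ms x))\<^sup>2 * B)"
    unfolding qaoa_mean_def using assms by (intro sum_mono mult_left_mono) auto
  also have "\<dots> = qaoa_mean V h \<beta> \<gamma> ms (\<lambda>_. 1) * B"
    unfolding qaoa_mean_def by (simp add: sum_distrib_right)
  finally show ?thesis using qaoa_mean_one[OF assms(1)] by simp
qed

lemma qaoa_mean_cong:
  "(\<And>x. x \<in> bitstrings V \<Longrightarrow> f x = f' x) \<Longrightarrow> qaoa_mean V h \<beta> \<gamma> ms f = qaoa_mean V h \<beta> \<gamma> ms f'"
  unfolding qaoa_mean_def by (intro sum.cong) auto

lemma qaoa_mean_add:
  "qaoa_mean V h \<beta> \<gamma> ms (\<lambda>x. f x + f' x) = qaoa_mean V h \<beta> \<gamma> ms f + qaoa_mean V h \<beta> \<gamma> ms f'"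
  unfolding qaoa_mean_def by (simp add: distrib_left sum.distrib)

lemma qaoa_mean_sum:
  "qaoa_mean V h \<beta> \<gamma> ms (\<lambda>x. \<Sum>k\<in>K. f k x) = (\<Sum>k\<in>K. qaoa_mean V h \<beta> \<gamma> ms (f k))"
  unfolding qaoa_mean_def sum_distrib_left by (rule sum.swap)

lemma qaoa_mean_cmult:
  "qaoa_mean V h \<beta> \<gamma> ms (\<lambda>x. a * f x) = a * qaoa_mean V h \<beta> \<gamma> ms f"
  unfolding qaoa_mean_def sum_distrib_left by (simp add: mult_ac)

lemma qaoa_mean_const: "finite V \<Longrightarrow> qaoa_mean V h \<beta> \<gamma> ms (\<lambda>_. c) = c"
  using qaoa_mean_cmult[of V h \<beta> \<gamma> ms c "\<lambda>_. 1"] by (simp add: qaoa_mean_one)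

section \<open>Sites where a kernel acts as the identity, and light cones\<close>

definition trivial_at :: "'v set \<Rightarrow> 'v \<Rightarrow> ('v bits \<Rightarrow> 'v bits \<Rightarrow> complex) \<Rightarrow> bool" where
  "trivial_at V k A \<longleftrightarrow> (\<forall>x\<in>bitstrings V. \<forall>y\<in>bitstrings V.
     (x k \<noteq> y k \<longrightarrow> A x y = 0) \<and> A (flip k x) (flip k y) = A x y)"

lemma trivial_atD:
  assumes "trivial_at V k A" "x \<in> bitstrings V" "y \<in> bitstrings V"
  shows "x k \<noteq> y k \<Longrightarrow> A x y = 0" and "A (flip k x) (flip k y) = A x y"
  using assms unfolding trivial_at_def by blast+

lemma mixer_kernel_flip_flip:
  assumes "x \<in> bitstrings V" "y \<in> bitstrings V" "k \<in> V"
  shows "mixer_kernel V b (flip k x) (flip k y) = mixer_kernel V b x y"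
  unfolding mixer_kernel_def
  using bitstrings_cases[OF assms(1,3)] bitstrings_cases[OF assms(2,3)]
  by (intro prod.cong refl) (auto simp: flip_def)

lemma mixer_kernel_remove:
  assumes "finite V" "k \<in> V"
  shows "mixer_kernel V b x y =
    (if x k = y k then of_real (cos b) else \<i> * of_real (sin b)) * mixer_kernel (V - {k}) b x y"
  unfolding mixer_kernel_def using assms by (simp add: prod.remove)

lemma mixer_kernel_remove_flip:
  "mixer_kernel (V - {k}) b (flip k x) y = mixer_kernel (V - {k}) b x y"
  unfolding mixer_kernel_def by (intro prod.cong) (auto simp: flip_def)

text \<open>\<open>trivial_at V k A\<close> means that A is a tensor product with the identity at k.
  The mixer is a tensor product too, and its one-qubit unitary at k cancels against the
  adjoint.\<close>

lemma trivial_at_mixer_conj: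
  assumes V: "finite V" and k: "k \<in> V" and A: "trivial_at V k A"
  shows "trivial_at V k (mixer_conj V b A)"
  unfolding trivial_at_def
proof (intro ballI conjI impI)
  fix x y assume x: "x \<in> bitstrings V" and y: "y \<in> bitstrings V"
  let ?K = "mixer_kernel V b" and ?B = "bitstrings V"
  have double_flip: "(\<Sum>u\<in>?B. \<Sum>v\<in>?B. G (flip k u) (flip k v)) = (\<Sum>u\<in>?B. \<Sum>v\<in>?B. G u v)"
    for G :: "'a bits \<Rightarrow> 'a bits \<Rightarrow> complex"
    using sum_flip[OF k, of "\<lambda>u. \<Sum>v\<in>?B. G u v"] by (simp only: sum_flip[OF k])
  have "mixer_conj V b A (flip k x) (flip k y) =
      (\<Sum>u\<in>?B. \<Sum>v\<in>?B. cnj (?K (flip k u) (flip k x)) * A (flip k u) (flip k v) * ?K (flip k v) (flip k y))"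
    unfolding mixer_conj_def
    by (rule double_flip[symmetric])
  also have "\<dots> = mixer_conj V b A x y"
    unfolding mixer_conj_def
    by (intro sum.cong refl) (simp only: mixer_kernel_flip_flip x y k trivial_atD(2)[OF A])
  finally show "mixer_conj V b A (flip k x) (flip k y) = mixer_conj V b A x y" .
  assume ne: "x k \<noteq> y k"
  define F where "F u v = cnj (?K u x) * A u v * ?K v y" for u v
  \<comment> \<open>If \<open>u k\<close> and \<open>v k\<close> differ, A vanishes. If they agree,
    then, as \<open>x k\<close> and \<open>y k\<close> differ, exactly one of the two kernels has
    the factor i sin b at k; the double flip moves it to or from the conjugated side, which changes
    the sign.\<close>
  have "F (flip k u) (flip k v) = - F u v" if u: "u \<in> ?B" and v: "v \<in> ?B" for u v
  proof (cases "u k = v k")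
    case False
    then show ?thesis using trivial_atD(1)[OF A u v] trivial_atD(2)[OF A u v] by (simp add: F_def)
  next
    case True
    have bits: "u k = 0 \<or> u k = 1" "x k = 0 \<or> x k = 1" "y k = 0 \<or> y k = 1"
      using bitstrings_cases[OF u k] bitstrings_cases[OF x k] bitstrings_cases[OF y k] .
    have fk: "flip k u k = 1 - u k" "flip k v k = 1 - v k" by (simp_all add: flip_def)
    define c d where "c = complex_of_real (cos b)" and "d = \<i> * complex_of_real (sin b)"
    have "cnj c = c" "cnj d = - d" by (simp_all add: c_def d_def)
    then show ?thesis
      unfolding F_def trivial_atD(2)[OF A u v] mixer_kernel_remove[OF V k] mixer_kernel_remove_flip fk
        c_def[symmetric] d_def[symmetric]
      using bits ne True by (elim disjE) simp_all
  qed
  then have "(\<Sum>u\<in>?B. \<Sum>v\<in>?B. F (flip k u) (flip k v)) = - (\<Sum>u\<in>?B. \<Sum>v\<in>?B. F u v)"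
    by (simp add: sum_negf)
  then have "mixer_conj V b A x y = - mixer_conj V b A x y"
    unfolding double_flip mixer_conj_def F_def[symmetric] .
  then show "mixer_conj V b A x y = 0" by simp
qed

text \<open>A light cone argument. \<open>S i\<close> bounds the support of the observable after i
  layers, so the kernel vanishes unless the two bit strings agree off \<open>S i\<close>. For such
  pairs \<open>phase\<close> makes the layers of \<open>h'\<close> and \<open>h\<close> equal, and
  \<open>spread\<close> says that the phase ignores the sites off \<open>S (Suc i)\<close>, so the
  next kernel is trivial there.\<close>

lemma kernel_form_local:
  assumes V: "finite V"
    and mono: "\<And>i. i < p \<Longrightarrow> S i \<subseteq> S (Suc i)"
    and phase: "\<And>i x y. i < p \<Longrightarrow> x \<in> bitstrings V \<Longrightarrow> y \<in> bitstrings V \<Longrightarrow>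
      (\<And>k. k \<in> V - S i \<Longrightarrow> x k = y k) \<Longrightarrow> h' y - h' x = h y - h x"
    and spread: "\<And>i k x y. i < p \<Longrightarrow> k \<in> V - S (Suc i) \<Longrightarrow> x \<in> bitstrings V \<Longrightarrow> y \<in> bitstrings V \<Longrightarrow>
      (\<And>k. k \<in> V - S i \<Longrightarrow> x k = y k) \<Longrightarrow> h (flip k y) - h (flip k x) = h y - h x"
    and "i + length ms \<le> p" "\<And>k. k \<in> V - S i \<Longrightarrow> trivial_at V k A"
  shows "kernel_form V A (qaoa_amp V h' \<beta> \<gamma> ms) = kernel_form V A (qaoa_amp V h \<beta> \<gamma> ms)"
  using assms(5,6)
proof (induction ms arbitrary: i A)
  case (Cons m ms)
  let ?M = "mixer_conj V (\<beta> m) A" and ?L = "\<lambda>h. layer_conj V h (\<beta> m) (\<gamma> m) A"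
  from Cons.prems have i: "i < p" by simp
  have M: "trivial_at V k ?M" if "k \<in> V - S i" for k
    using trivial_at_mixer_conj[OF V _ Cons.prems(2)[OF that]] that by simp
  have agree: "x k = y k" if "?M x y \<noteq> 0" "x \<in> bitstrings V" "y \<in> bitstrings V" "k \<in> V - S i" for x y k
    using trivial_atD(1)[OF M[OF that(4)] that(2,3)] that(1) by blast
  have "?L h' x y = ?L h x y" if "x \<in> bitstrings V" "y \<in> bitstrings V" for x y
  proof (cases "?M x y = 0")
    case False
    have "h' y - h' x = h y - h x"
      using phase[OF i that] agree[OF False that] by blast
    then show ?thesis unfolding layer_conj_def by (simp only:)
  qed (simp add: layer_conj_def)
  then have "kernel_form V (?L h') \<psi> = kernel_form V (?L h) \<psi>" for \<psi>
    unfolding kernel_form_def by (intro sum.cong refl) simp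
  moreover have "trivial_at V k (?L h)" if k: "k \<in> V - S (Suc i)" for k
  proof -
    have Mk: "trivial_at V k ?M" using k mono[OF i] by (intro M) auto
    show ?thesis
      unfolding trivial_at_def
    proof (intro ballI conjI impI)
      fix x y assume x: "x \<in> bitstrings V" and y: "y \<in> bitstrings V"
      show "?L h x y = 0" if "x k \<noteq> y k"
        using trivial_atD(1)[OF Mk x y that] by (simp add: layer_conj_def)
      note * = trivial_atD(2)[OF Mk x y]
      show "?L h (flip k x) (flip k y) = ?L h x y"
      proof (cases "?M x y = 0")
        case False
        have "h (flip k y) - h (flip k x) = h y - h x"
          using spread[OF i k x y] agree[OF False x y] by blast
        then show ?thesis unfolding layer_conj_def * by (simp only:)
      qed (simp add: layer_conj_def *)
    qed
  qed
  ultimately show ?case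
    using Cons.IH[of "Suc i" "?L h"] Cons.prems(1) unfolding qaoa_amp_Cons kernel_form_layer by simp
qed simp

section \<open>Symmetries: permutations of sites combined with bit flips\<close>

definition relabel :: "'v set \<Rightarrow> ('v \<Rightarrow> 'v) \<Rightarrow> 'v set \<Rightarrow> 'v bits \<Rightarrow> 'v bits" where
  "relabel V \<sigma> F x = (\<lambda>v\<in>V. if v \<in> F then 1 - x (\<sigma> v) else x (\<sigma> v))"

lemma relabel_eq_iff:
  assumes "bij_betw \<sigma> V V" "x \<in> bitstrings V" "y \<in> bitstrings V" "v \<in> V"
  shows "relabel V \<sigma> F x v = relabel V \<sigma> F y v \<longleftrightarrow> x (\<sigma> v) = y (\<sigma> v)"
proof -
  have "\<sigma> v \<in> V" using assms(1,4) by (auto dest: bij_betwE)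
  then show ?thesis
    using bitstrings_cases[OF assms(2), of "\<sigma> v"] bitstrings_cases[OF assms(3), of "\<sigma> v"] assms(4)
    by (auto simp: relabel_def)
qed

lemma bij_betw_relabel:
  assumes V: "finite V" and \<sigma>: "bij_betw \<sigma> V V"
  shows "bij_betw (relabel V \<sigma> F) (bitstrings V) (bitstrings V)"
proof -
  have "inj_on (relabel V \<sigma> F) (bitstrings V)"
  proof (rule inj_onI)
    fix x y assume x: "x \<in> bitstrings V" and y: "y \<in> bitstrings V"
      and eq: "relabel V \<sigma> F x = relabel V \<sigma> F y"
    show "x = y"
    proof (rule bitstrings_eqI[OF x y])
      fix k assume "k \<in> V"
      then obtain v where "v \<in> V" "k = \<sigma> v" using \<sigma> by (auto simp: bij_betw_def)
      then show "x k = y k" using relabel_eq_iff[OF \<sigma> x y, of v F] eq by simp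
    qed
  qed
  moreover have "relabel V \<sigma> F ` bitstrings V \<subseteq> bitstrings V"
  proof (rule image_subsetI)
    fix x assume x: "x \<in> bitstrings V"
    have "x (\<sigma> v) = 0 \<or> x (\<sigma> v) = 1" if "v \<in> V" for v
      using bitstrings_cases[OF x, of "\<sigma> v"] \<sigma> that by (auto dest: bij_betwE)
    then show "relabel V \<sigma> F x \<in> bitstrings V"
      by (auto simp: relabel_def bitstrings_def PiE_iff)
  qed
  ultimately show ?thesis
    using V by (simp add: bij_betw_def endo_inj_surj)
qed

text \<open>The kernel depends only on the number of sites where its arguments differ, which neither
  a permutation of the sites nor a common flip alters.\<close>

lemma mixer_kernel_relabel:
  assumes "bij_betw \<sigma> V V" "x \<in> bitstrings V" "y \<in> bitstrings V"
  shows "mixer_kernel V b (relabel V \<sigma> F x) (relabel V \<sigma> F y) = mixer_kernel V b x y"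
proof -
  have "mixer_kernel V b (relabel V \<sigma> F x) (relabel V \<sigma> F y) =
      (\<Prod>v\<in>V. if x (\<sigma> v) = y (\<sigma> v) then of_real (cos b) else \<i> * of_real (sin b))"
    unfolding mixer_kernel_def by (rule prod.cong) (simp_all add: relabel_eq_iff[OF assms])
  also have "\<dots> = mixer_kernel V b x y"
    unfolding mixer_kernel_def by (rule prod.reindex_bij_betw[OF assms(1)])
  finally show ?thesis .
qed

text \<open>The relabelling commutes with the mixer and fixes both \<open>h\<close> and the plus
  state, so it preserves every amplitude.\<close>

lemma qaoa_mean_relabel:
  assumes V: "finite V" and \<sigma>: "bij_betw \<sigma> V V"
    and h: "\<And>x. x \<in> bitstrings V \<Longrightarrow> h (relabel V \<sigma> F x) = h x"
  shows "qaoa_mean V h \<beta> \<gamma> ms (\<lambda>x. f (relabel V \<sigma> F x)) = qaoa_mean V h \<beta> \<gamma> ms f"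
proof -
  let ?T = "relabel V \<sigma> F"
  note bij = bij_betw_relabel[OF V \<sigma>, of F]
  have amp: "qaoa_amp V h \<beta> \<gamma> ms (?T x) = qaoa_amp V h \<beta> \<gamma> ms x" if "x \<in> bitstrings V" for x
    using that
  proof (induction ms arbitrary: x)
    case (Cons m ms)
    have "qaoa_amp V h \<beta> \<gamma> (m # ms) (?T x) =
        (\<Sum>y\<in>bitstrings V. mixer_kernel V (\<beta> m) (?T x) (?T y) *
          (exp (\<i> * of_real (\<gamma> m * h (?T y))) * qaoa_amp V h \<beta> \<gamma> ms (?T y)))"
      unfolding qaoa_amp_Cons qaoa_layer_def by (rule sum.reindex_bij_betw[OF bij, symmetric])
    also have "\<dots> = qaoa_amp V h \<beta> \<gamma> (m # ms) x"
      unfolding qaoa_amp_Cons qaoa_layer_def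
      by (rule sum.cong) (simp_all add: mixer_kernel_relabel[OF \<sigma>] Cons h)
    finally show ?case .
  qed (simp add: plus_state_def)
  have "qaoa_mean V h \<beta> \<gamma> ms f = (\<Sum>x\<in>bitstrings V. (cmod (qaoa_amp V h \<beta> \<gamma> ms (?T x)))\<^sup>2 * f (?T x))"
    unfolding qaoa_mean_def by (rule sum.reindex_bij_betw[OF bij, symmetric])
  also have "\<dots> = qaoa_mean V h \<beta> \<gamma> ms (\<lambda>x. f (?T x))"
    unfolding qaoa_mean_def by (rule sum.cong) (simp_all add: amp)
  finally show ?thesis ..
qed

section \<open>Optimal level-1 energies\<close>

abbreviation level1_energy :: "'v set \<Rightarrow> ('v bits \<Rightarrow> real) \<Rightarrow> real \<Rightarrow> real \<Rightarrow> real" where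
  "level1_energy V h b g \<equiv> qaoa_mean V h (\<lambda>_. b) (\<lambda>_. g) [1] h"

text \<open>Integrality is there for \<open>g\<close>: the phases exp (i g h) then have period 2
  pi.\<close>

lemma level1_energy_periodic:
  assumes "\<And>x. x \<in> bitstrings V \<Longrightarrow> h x \<in> \<int>"
  shows "level1_energy V h (b + 2 * pi * of_int m) (g + 2 * pi * of_int l) = level1_energy V h b g"
proof -
  have trig: "sin (b + 2 * pi * of_int m) = sin b" "cos (b + 2 * pi * of_int m) = cos b"
    using sin_cos_eq_iff[of "b + 2 * pi * of_int m" b] by (auto simp: mult_ac)
  have "exp (\<i> * of_real ((g + 2 * pi * of_int l) * h y)) = exp (\<i> * of_real (g * h y))"
    if "y \<in> bitstrings V" for y
  proof -
    from assms[OF that] obtain k where k: "h y = of_int k" by (auto elim: Ints_cases)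
    show ?thesis
      unfolding exp_eq by (rule exI[of _ "l * k"]) (simp add: k algebra_simps)
  qed
  then show ?thesis
    unfolding qaoa_mean_def qaoa_amp_Cons qaoa_layer_def
    unfolding mixer_kernel_def trig
    by (intro sum.cong refl arg_cong2[where f = "(*)"] arg_cong[where f = "\<lambda>z. (cmod z)\<^sup>2"])
      simp_all
qed

lemma continuous_on_mixer_kernel [continuous_intros]:
  fixes f :: "'p::t2_space \<Rightarrow> real"
  assumes "continuous_on S f"
  shows "continuous_on S (\<lambda>p. mixer_kernel V (f p) x y)"
proof -
  have "continuous_on S (\<lambda>p. if x k = y k then complex_of_real (cos (f p)) else \<i> * of_real (sin (f p)))" for k
    by (cases "x k = y k") (auto intro!: continuous_intros assms)
  then show ?thesis unfolding mixer_kernel_def by (intro continuous_on_prod) auto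
qed

text \<open>By periodicity the supremum over the plane is that over a compact square. Each
  elimination step of RQAOA needs such a maximizer.\<close>

lemma level1_energy_max_exists:
  assumes "\<And>x. x \<in> bitstrings V \<Longrightarrow> h x \<in> \<int>"
  shows "\<exists>b g. \<forall>b' g'. level1_energy V h b' g' \<le> level1_energy V h b g"
proof -
  let ?E = "\<lambda>p. level1_energy V h (fst p) (snd p)"
  define Q where "Q = {0..2 * pi} \<times> {0..2 * pi}"
  have "continuous_on Q ?E"
    unfolding qaoa_mean_def qaoa_amp_Cons qaoa_amp_Nil qaoa_layer_def by (intro continuous_intros)
  moreover have "compact Q" "Q \<noteq> {}" by (auto simp: Q_def intro: compact_Times)
  ultimately obtain q where q: "\<And>p. p \<in> Q \<Longrightarrow> ?E p \<le> ?E q"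
    using continuous_attains_sup[of Q ?E] by blast
  have "level1_energy V h b g \<le> ?E q" for b g
  proof -
    define r where "r t = t + 2 * pi * of_int (- \<lfloor>t / (2 * pi)\<rfloor>)" for t
    have r: "r t \<in> {0..2 * pi}" for t
    proof -
      define q where "q = real_of_int \<lfloor>t / (2 * pi)\<rfloor>"
      have "q \<le> t / (2 * pi)" "t / (2 * pi) \<le> q + 1"
        unfolding q_def by linarith+
      then have "q * (2 * pi) \<le> t" "t \<le> (q + 1) * (2 * pi)"
        by (simp_all add: pos_le_divide_eq pos_divide_le_eq)
      then show ?thesis by (simp add: r_def q_def algebra_simps)
    qed
    have "level1_energy V h b g = ?E (r b, r g)"
      using level1_energy_periodic[of V h b "- \<lfloor>b / (2 * pi)\<rfloor>" g "- \<lfloor>g / (2 * pi)\<rfloor>", OF assms]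
      by (simp add: r_def)
    also have "\<dots> \<le> ?E q" using r by (intro q) (simp add: Q_def)
    finally show ?thesis .
  qed
  then show ?thesis by blast
qed

section \<open>First-order expansion in the mixer angle\<close>

lemma mixer_kernel_hamming:
  assumes "finite V"
  shows "mixer_kernel V b x y =
    of_real (cos b ^ (card V - card {k \<in> V. x k \<noteq> y k}) * sin b ^ card {k \<in> V. x k \<noteq> y k}) *
    \<i> ^ card {k \<in> V. x k \<noteq> y k}"
proof -
  have "V \<inter> {k. x k = y k} = V - {k \<in> V. x k \<noteq> y k}" "V \<inter> - {k. x k = y k} = {k \<in> V. x k \<noteq> y k}"
    by auto
  moreover have "card (V - {k \<in> V. x k \<noteq> y k}) = card V - card {k \<in> V. x k \<noteq> y k}"
    using assms by (intro card_Diff_subset) auto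
  ultimately show ?thesis
    unfolding mixer_kernel_def prod.If_cases[OF assms] by (simp add: power_mult_distrib mult_ac)
qed

lemma sum_hamming_1:
  assumes V: "finite V" and x: "x \<in> bitstrings V"
  shows "(\<Sum>y\<in>bitstrings V. if card {k \<in> V. x k \<noteq> y k} = 1 then F y else 0) = (\<Sum>k\<in>V. F (flip k x))"
proof -
  have ne: "flip k x k \<noteq> x k" if "k \<in> V" for k
    using bitstrings_cases[OF x that] by (auto simp: flip_def)
  have inj: "inj_on (\<lambda>k. flip k x) V"
  proof (rule inj_onI, rule ccontr)
    fix k l assume kl: "k \<in> V" "l \<in> V" "flip k x = flip l x" "k \<noteq> l"
    have "flip l x k = x k" using kl(4) by (simp add: flip_def)
    with ne[OF kl(1)] kl(3) show False by metis
  qed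
  have "{y \<in> bitstrings V. card {k \<in> V. x k \<noteq> y k} = 1} = (\<lambda>k. flip k x) ` V"
  proof (intro equalityI subsetI)
    fix y assume "y \<in> {y \<in> bitstrings V. card {k \<in> V. x k \<noteq> y k} = 1}"
    then have y: "y \<in> bitstrings V" and "card {k \<in> V. x k \<noteq> y k} = 1" by simp_all
    then obtain k where "{k \<in> V. x k \<noteq> y k} = {k}" by (metis card_1_singletonE)
    then have k: "l \<in> V \<and> x l \<noteq> y l \<longleftrightarrow> l = k" for l by (simp only: set_eq_iff mem_Collect_eq singleton_iff)
    have kV: "k \<in> V" and "x k \<noteq> y k" using k[of k] by simp_all
    then have "y k = 1 - x k"
      using bitstrings_cases[OF x kV] bitstrings_cases[OF y kV] by auto
    then have "y l = flip k x l" if "l \<in> V" for l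
      using k[of l] that by (cases "l = k") (simp_all add: flip_def)
    then have "y = flip k x"
      by (rule bitstrings_eqI[OF y flip_bitstrings[OF x kV]])
    then show "y \<in> (\<lambda>k. flip k x) ` V" using kV by blast
  next
    fix y assume "y \<in> (\<lambda>k. flip k x) ` V"
    then obtain k where k: "k \<in> V" and y: "y = flip k x" by blast
    have "x l \<noteq> y l \<longleftrightarrow> l = k" for l
      using ne[OF k] unfolding y by (cases "l = k") (simp_all add: flip_def)
    then have "{l \<in> V. x l \<noteq> y l} = {k}" using k by auto
    then show "y \<in> {y \<in> bitstrings V. card {k \<in> V. x k \<noteq> y k} = 1}"
      using k x y by simp
  qed
  then show ?thesis
    unfolding sum.inter_filter[OF finite_bitstrings[OF V], symmetric]
    by (simp add: sum.reindex[OF inj])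
qed

text \<open>To first order at angle 0 only Hamming distance 1 contributes: cos has derivative 0
  there, and the higher powers of sin vanish to second order.\<close>

lemma DERIV_hamming_weight:
  "((\<lambda>b::real. cos b ^ m * sin b ^ d) has_real_derivative (if d = 1 then 1 else 0)) (at 0)"
  by (rule derivative_eq_intros refl)+ (cases d; auto simp: power_0_left)

text \<open>The derivative of the energy in \<open>b\<close> at \<open>b = 0\<close> is a mean of terms \<open>t sin (g t)\<close>, where
  \<open>t\<close> runs over the changes of \<open>h\<close> under single bit flips.\<close>

lemma level1_energy_exceeds_mean:
  assumes V: "finite V" and x0: "x0 \<in> bitstrings V" and k0: "k0 \<in> V" and h0: "h (flip k0 x0) \<noteq> h x0"
  shows "\<exists>b g. (\<Sum>x\<in>bitstrings V. h x) / 2 ^ card V < level1_energy V h b g"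
proof -
  let ?B = "bitstrings V"
  define c where "c = (1 / sqrt 2) ^ card V"
  have plus: "plus_state V x = of_real c" for x
    by (simp add: plus_state_def c_def)
  have c2: "c * c = 1 / 2 ^ card V" and "c > 0"
    by (simp_all add: c_def power_mult_distrib[symmetric] power_one_over)
  \<comment> \<open>\<open>M\<close> exceeds every energy difference t, so with
    \<open>g = 1 / M\<close> the arguments g t of the sine lie between -1 and 1, where t sin (g t)
    is positive for nonzero t.\<close>
  define M where "M = 1 + 2 * (\<Sum>x\<in>?B. \<bar>h x\<bar>)"
  define g where "g = 1 / M"
  have "M \<ge> 1" unfolding M_def by (simp add: sum_nonneg)
  have diff: "\<bar>h x - h y\<bar> < M" if "x \<in> ?B" "y \<in> ?B" for x y
  proof -
    have "\<bar>h x\<bar> \<le> (\<Sum>x\<in>?B. \<bar>h x\<bar>)" "\<bar>h y\<bar> \<le> (\<Sum>x\<in>?B. \<bar>h x\<bar>)"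
      using V that by (auto intro!: member_le_sum)
    then show ?thesis unfolding M_def by linarith
  qed
  define T where "T t = t * sin (g * t)" for t
  have T_pos: "0 < T t" if "\<bar>t\<bar> < M" "t \<noteq> 0" for t
  proof -
    have "\<bar>g * t\<bar> < 1" using that(1) \<open>M \<ge> 1\<close> by (simp add: g_def abs_mult)
    then have "\<bar>g * t\<bar> < pi" using pi_gt3 by linarith
    moreover have "g > 0" using \<open>M \<ge> 1\<close> by (simp add: g_def)
    ultimately show ?thesis
      using that(2) sin_gt_zero[of "g * t"] sin_gt_zero[of "- (g * t)"]
      by (cases "t > 0") (auto simp: T_def mult_neg_neg mult_pos_neg abs_less_iff)
  qed
  define \<phi> where "\<phi> y = exp (\<i> * of_real (g * h y)) * complex_of_real c" for y
  have Re_\<phi>: "Re (\<phi> y) = c * cos (g * h y)" and Im_\<phi>: "Im (\<phi> y) = c * sin (g * h y)" for y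
    by (simp_all add: \<phi>_def Re_exp Im_exp)
  define amp where "amp b = qaoa_amp V h (\<lambda>_. b) (\<lambda>_. g) [1]" for b
  have amp_0: "amp 0 x = \<phi> x" if "x \<in> ?B" for x
  proof -
    have "amp 0 x = (\<Sum>y\<in>?B. if y = x then \<phi> y else 0)"
      unfolding amp_def qaoa_amp_Cons qaoa_layer_def
      by (rule sum.cong) (auto simp: mixer_kernel_0[OF V that] \<phi>_def plus)
    then show ?thesis using V that by simp
  qed
  define d where "d x y = card {k \<in> V. x k \<noteq> y k}" for x y :: "'a bits"
  define w where "w x y b = cos b ^ (card V - d x y) * sin b ^ d x y" for x y and b :: real
  have amp: "amp b x = (\<Sum>y\<in>?B. of_real (w x y b) * (\<i> ^ d x y * \<phi> y))" for b x
    unfolding amp_def qaoa_amp_Cons qaoa_layer_def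
    by (rule sum.cong) (simp_all add: mixer_kernel_hamming[OF V] \<phi>_def plus d_def w_def mult_ac)
  have w': "((\<lambda>b. w x y b) has_real_derivative (if d x y = 1 then 1 else 0)) (at 0)" for x y
    unfolding w_def by (rule DERIV_hamming_weight)
  have Re_scale: "Re (of_real r * z) = r * Re z" and Im_scale: "Im (of_real r * z) = r * Im z" for r z
    by simp_all
  have dRe: "((\<lambda>b. Re (amp b x)) has_real_derivative - c * (\<Sum>k\<in>V. sin (g * h (flip k x)))) (at 0)"
    and dIm: "((\<lambda>b. Im (amp b x)) has_real_derivative c * (\<Sum>k\<in>V. cos (g * h (flip k x)))) (at 0)"
    if x: "x \<in> ?B" for x
  proof -
    have "((\<lambda>b. Re (amp b x)) has_real_derivative
        (\<Sum>y\<in>?B. (if d x y = 1 then 1 else 0) * Re (\<i> ^ d x y * \<phi> y))) (at 0)"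
      unfolding amp Re_sum Re_scale
      by (intro DERIV_sum DERIV_cmult_right w')
    also have "(\<Sum>y\<in>?B. (if d x y = 1 then 1 else 0) * Re (\<i> ^ d x y * \<phi> y)) =
        (\<Sum>y\<in>?B. if d x y = 1 then - (c * sin (g * h y)) else 0)"
      by (rule sum.cong) (auto simp: Im_\<phi>)
    also have "\<dots> = - c * (\<Sum>k\<in>V. sin (g * h (flip k x)))"
      unfolding d_def sum_hamming_1[OF V x] by (simp add: sum_negf sum_distrib_left)
    finally show "((\<lambda>b. Re (amp b x)) has_real_derivative - c * (\<Sum>k\<in>V. sin (g * h (flip k x)))) (at 0)" .
    have "((\<lambda>b. Im (amp b x)) has_real_derivative
        (\<Sum>y\<in>?B. (if d x y = 1 then 1 else 0) * Im (\<i> ^ d x y * \<phi> y))) (at 0)"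
      unfolding amp Im_sum Im_scale
      by (intro DERIV_sum DERIV_cmult_right w')
    also have "(\<Sum>y\<in>?B. (if d x y = 1 then 1 else 0) * Im (\<i> ^ d x y * \<phi> y)) =
        (\<Sum>y\<in>?B. if d x y = 1 then c * cos (g * h y) else 0)"
      by (rule sum.cong) (auto simp: Re_\<phi>)
    also have "\<dots> = c * (\<Sum>k\<in>V. cos (g * h (flip k x)))"
      unfolding d_def sum_hamming_1[OF V x] by (simp add: sum_distrib_left)
    finally show "((\<lambda>b. Im (amp b x)) has_real_derivative c * (\<Sum>k\<in>V. cos (g * h (flip k x)))) (at 0)" .
  qed
  let ?f = "\<lambda>b. level1_energy V h b g"
  let ?s = "\<lambda>k x. sin (g * (h x - h (flip k x)))"
  have f: "?f b = (\<Sum>x\<in>?B. ((Re (amp b x))\<^sup>2 + (Im (amp b x))\<^sup>2) * h x)" for b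
    unfolding qaoa_mean_def amp_def[symmetric] cmod_power2 ..
  have "((\<lambda>b. ((Re (amp b x))\<^sup>2 + (Im (amp b x))\<^sup>2) * h x) has_real_derivative
      (2 * Re (amp 0 x) * (- c * (\<Sum>k\<in>V. sin (g * h (flip k x)))) +
       2 * Im (amp 0 x) * (c * (\<Sum>k\<in>V. cos (g * h (flip k x))))) * h x) (at 0)" if "x \<in> ?B" for x
    using DERIV_cmult_right[OF DERIV_add[OF DERIV_power[OF dRe[OF that], of 2]
      DERIV_power[OF dIm[OF that], of 2]], of "h x"] by (simp add: mult_ac)
  then have "(?f has_real_derivative
      (\<Sum>x\<in>?B. (2 * Re (amp 0 x) * (- c * (\<Sum>k\<in>V. sin (g * h (flip k x)))) +
                2 * Im (amp 0 x) * (c * (\<Sum>k\<in>V. cos (g * h (flip k x))))) * h x)) (at 0)"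
    unfolding f
    by (rule DERIV_sum)
  also have "(\<Sum>x\<in>?B. (2 * Re (amp 0 x) * (- c * (\<Sum>k\<in>V. sin (g * h (flip k x)))) +
                2 * Im (amp 0 x) * (c * (\<Sum>k\<in>V. cos (g * h (flip k x))))) * h x) =
      (\<Sum>x\<in>?B. 2 * (c * c) * (\<Sum>k\<in>V. h x * ?s k x))"
  proof (rule sum.cong)
    fix x assume x: "x \<in> ?B"
    \<comment> \<open>The subtraction formula for the sine recombines the contributions of the real
      and the imaginary part.\<close>
    have "(\<Sum>k\<in>V. ?s k x) = (\<Sum>k\<in>V. sin (g * h x) * cos (g * h (flip k x)) - cos (g * h x) * sin (g * h (flip k x)))"
      by (simp add: right_diff_distrib sin_diff)
    also have "\<dots> = sin (g * h x) * (\<Sum>k\<in>V. cos (g * h (flip k x))) - cos (g * h x) * (\<Sum>k\<in>V. sin (g * h (flip k x)))"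
      by (simp add: sum_subtractf sum_distrib_left)
    finally have "2 * (c * c) * (\<Sum>k\<in>V. h x * ?s k x) = 2 * (c * c) * h x * (sin (g * h x) * (\<Sum>k\<in>V. cos (g * h (flip k x))) - cos (g * h x) * (\<Sum>k\<in>V. sin (g * h (flip k x))))"
      by (simp add: sum_distrib_left[symmetric] mult.assoc)
    also have "\<dots> = (2 * Re (amp 0 x) * (- c * (\<Sum>k\<in>V. sin (g * h (flip k x)))) +
                2 * Im (amp 0 x) * (c * (\<Sum>k\<in>V. cos (g * h (flip k x))))) * h x"
      unfolding amp_0[OF x] Re_\<phi> Im_\<phi> by (simp only: algebra_simps)
    finally show "(2 * Re (amp 0 x) * (- c * (\<Sum>k\<in>V. sin (g * h (flip k x)))) +
                2 * Im (amp 0 x) * (c * (\<Sum>k\<in>V. cos (g * h (flip k x))))) * h x =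
        2 * (c * c) * (\<Sum>k\<in>V. h x * ?s k x)" ..
  qed simp
  also have "\<dots> = 2 * (c * c) * (\<Sum>x\<in>?B. \<Sum>k\<in>V. h x * ?s k x)"
    by (simp only: sum_distrib_left)
  also have "2 * (c * c) * (\<Sum>x\<in>?B. \<Sum>k\<in>V. h x * ?s k x) = c * c * (\<Sum>k\<in>V. \<Sum>x\<in>?B. T (h x - h (flip k x)))"
  proof -
    \<comment> \<open>Symmetrisation: averaging the summands at x and at \<open>flip k x\<close>,
      where the sine changes sign, replaces \<open>h x\<close> by half the energy change.\<close>
    have "2 * (\<Sum>x\<in>?B. h x * ?s k x) = (\<Sum>x\<in>?B. T (h x - h (flip k x)))" if "k \<in> V" for k
    proof -
      have "(\<Sum>x\<in>?B. h x * ?s k x) = (\<Sum>x\<in>?B. h (flip k x) * ?s k (flip k x))"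
        by (rule sum_flip[OF that, symmetric])
      also have "\<dots> = (\<Sum>x\<in>?B. - h (flip k x) * ?s k x)"
      proof (rule sum.cong)
        fix x assume "x \<in> ?B"
        have "?s k (flip k x) = sin (- (g * (h x - h (flip k x))))"
          unfolding flip_flip[OF \<open>x \<in> ?B\<close> that] by (simp add: algebra_simps)
        then show "h (flip k x) * ?s k (flip k x) = - h (flip k x) * ?s k x" by simp
      qed simp
      finally have "2 * (\<Sum>x\<in>?B. h x * ?s k x) = (\<Sum>x\<in>?B. h x * ?s k x) + (\<Sum>x\<in>?B. - h (flip k x) * ?s k x)"
        by simp
      then show ?thesis by (simp add: T_def sum.distrib[symmetric] algebra_simps)
    qed
    then have "(\<Sum>k\<in>V. 2 * (\<Sum>x\<in>?B. h x * ?s k x)) = (\<Sum>k\<in>V. \<Sum>x\<in>?B. T (h x - h (flip k x)))"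
      by (rule sum.cong[OF refl])
    then have "2 * (\<Sum>x\<in>?B. \<Sum>k\<in>V. h x * ?s k x) = (\<Sum>k\<in>V. \<Sum>x\<in>?B. T (h x - h (flip k x)))"
      by (subst sum.swap) (simp only: sum_distrib_left)
    then show ?thesis by simp
  qed
  finally have deriv: "(?f has_real_derivative c * c * (\<Sum>k\<in>V. \<Sum>x\<in>?B. T (h x - h (flip k x)))) (at 0)" .
  have T_nonneg: "0 \<le> T (h x - h (flip k x))" if "k \<in> V" "x \<in> ?B" for k x
    using T_pos[of "h x - h (flip k x)"] diff[OF that(2) flip_bitstrings[OF that(2,1)]]
    by (cases "h x = h (flip k x)") (auto simp: T_def)
  have "0 < (\<Sum>x\<in>?B. T (h x - h (flip k0 x)))"
    using V h0 x0 k0 T_nonneg diff[OF x0 flip_bitstrings[OF x0 k0]] by (intro sum_pos2[of _ x0] T_pos) auto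
  then have "0 < (\<Sum>k\<in>V. \<Sum>x\<in>?B. T (h x - h (flip k x)))"
    using V k0 T_nonneg by (intro sum_pos2[of _ k0] sum_nonneg) auto
  then have "0 < c * c * (\<Sum>k\<in>V. \<Sum>x\<in>?B. T (h x - h (flip k x)))"
    using \<open>c > 0\<close> by simp
  from DERIV_pos_inc_right[OF deriv this] obtain e where "e > 0" "\<forall>b > 0. b < e \<longrightarrow> ?f 0 < ?f (0 + b)"
    by blast
  then have "?f 0 < ?f (e / 2)" by simp
  \<comment> \<open>At b = 0 only phases act on the uniform state, so the energy is the plain mean
    of \<open>h\<close>.\<close>
  moreover have "?f 0 = (\<Sum>x\<in>?B. h x) / 2 ^ card V"
    unfolding f sum_divide_distrib
  proof (rule sum.cong)
    fix x assume "x \<in> ?B"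
    have "(Re (\<phi> x))\<^sup>2 + (Im (\<phi> x))\<^sup>2 = c * c * ((cos (g * h x))\<^sup>2 + (sin (g * h x))\<^sup>2)"
      unfolding Re_\<phi> Im_\<phi> by (simp only: power_mult_distrib distrib_left power2_eq_square[of c])
    then show "((Re (amp 0 x))\<^sup>2 + (Im (amp 0 x))\<^sup>2) * h x = h x / 2 ^ card V"
      by (simp add: amp_0[OF \<open>x \<in> ?B\<close>] c2)
  qed simp
  ultimately show ?thesis by auto
qed

text \<open>Entry to the light cone: a diagonal observable that ignores site k has a kernel that is
  trivial at k, and \<open>kernel_form_local\<close> takes over.\<close>

lemma qaoa_mean_local:
  assumes V: "finite V"
    and mono: "\<And>i. i < p \<Longrightarrow> S i \<subseteq> S (Suc i)"
    and phase: "\<And>i x y. i < p \<Longrightarrow> x \<in> bitstrings V \<Longrightarrow> y \<in> bitstrings V \<Longrightarrow>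
      (\<And>k. k \<in> V - S i \<Longrightarrow> x k = y k) \<Longrightarrow> h' y - h' x = h y - h x"
    and spread: "\<And>i k x y. i < p \<Longrightarrow> k \<in> V - S (Suc i) \<Longrightarrow> x \<in> bitstrings V \<Longrightarrow> y \<in> bitstrings V \<Longrightarrow>
      (\<And>k. k \<in> V - S i \<Longrightarrow> x k = y k) \<Longrightarrow> h (flip k y) - h (flip k x) = h y - h x"
    and ms: "length ms \<le> p"
    and f: "\<And>k x. k \<in> V - S 0 \<Longrightarrow> x \<in> bitstrings V \<Longrightarrow> f (flip k x) = f x"
  shows "qaoa_mean V h' \<beta> \<gamma> ms f = qaoa_mean V h \<beta> \<gamma> ms f"
proof -
  let ?A = "\<lambda>x y. if x = y then complex_of_real (f x) else 0"
  have "trivial_at V k ?A" if k: "k \<in> V - S 0" for k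
    unfolding trivial_at_def
  proof (intro ballI conjI impI)
    fix x y assume x: "x \<in> bitstrings V" and y: "y \<in> bitstrings V"
    show "?A x y = 0" if "x k \<noteq> y k" using that by auto
    have "flip k x = flip k y \<longleftrightarrow> x = y"
      using flip_flip[OF x, of k] flip_flip[OF y, of k] k by (metis DiffD1)
    then show "?A (flip k x) (flip k y) = ?A x y"
      using f[OF k x] f[OF k y] by simp
  qed
  then have "kernel_form V ?A (qaoa_amp V h' \<beta> \<gamma> ms) = kernel_form V ?A (qaoa_amp V h \<beta> \<gamma> ms)"
    using ms by (intro kernel_form_local[where S = S and p = p and h = h and h' = h' and i = 0, OF V mono phase spread]) (assumption | simp)+
  then show ?thesis
    unfolding qaoa_mean_eq_kernel_form[OF V, symmetric] of_real_eq_iff .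
qed

section \<open>Maximizers of diagonal operators\<close>

lemma max_value_diag_op: "finite V \<Longrightarrow> max_value V (diag_op h) = Max (h ` bitstrings V)"
  unfolding max_value_def by (intro arg_cong[where f = Max] image_cong refl) (simp add: expval_ket)

lemma bitstrings_nonempty [simp]: "bitstrings V \<noteq> {}"
  unfolding bitstrings_def by (simp add: PiE_eq_empty_iff)

lemma is_maximizer_diag_op:
  assumes V: "finite V"
  shows "is_maximizer V (diag_op h) x \<longleftrightarrow> x \<in> bitstrings V \<and> (\<forall>y\<in>bitstrings V. h y \<le> h x)"
proof -
  have "Max (h ` bitstrings V) = h x \<longleftrightarrow> (\<forall>y\<in>bitstrings V. h y \<le> h x)" if "x \<in> bitstrings V"
    using V that by (subst Max_eq_iff) auto
  then show ?thesis
    unfolding is_maximizer_def max_value_diag_op[OF V] by (auto simp: expval_ket[OF V])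
qed

section \<open>Rings of couplings\<close>

text \<open>The ring sits in a possibly larger register through \<open>c\<close>; qubits outside its
  image are spectators. This allows rings of different lengths to be compared on one
  register.\<close>

definition ring_term :: "(nat \<Rightarrow> 'v) \<Rightarrow> nat \<Rightarrow> (nat \<Rightarrow> real) \<Rightarrow> nat \<Rightarrow> 'v bits \<Rightarrow> real" where
  "ring_term c M w k x = w k * (spin x (c k) * spin x (c (Suc k mod M)))"

definition ring_energy :: "(nat \<Rightarrow> 'v) \<Rightarrow> nat \<Rightarrow> (nat \<Rightarrow> real) \<Rightarrow> 'v bits \<Rightarrow> real" where
  "ring_energy c M w x = (\<Sum>k<M. ring_term c M w k x)"

lemma bij_betw_Suc_mod: "0 < M \<Longrightarrow> bij_betw (\<lambda>k. Suc k mod M) {..<M} {..<M}"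
proof -
  assume "0 < M"
  have "inj_on (\<lambda>k. Suc k mod M) {..<M}"
    by (rule inj_onI) (auto simp: mod_Suc split: if_splits)
  moreover have "(\<lambda>k. Suc k mod M) ` {..<M} \<subseteq> {..<M}" using \<open>0 < M\<close> by auto
  ultimately show ?thesis by (simp add: bij_betw_def endo_inj_surj)
qed

text \<open>Shifting the ring by one site while flipping the sites \<open>c k\<close> with \<open>w k = -1\<close> carries the
  term of edge \<open>k\<close> to the term of edge \<open>k + 1\<close>, whether or not the ring is frustrated.\<close>

lemma qaoa_mean_ring_term:
  assumes V: "finite V" and inj: "inj_on c {..<M}" and sub: "c ` {..<M} \<subseteq> V"
    and w: "\<And>k. k < M \<Longrightarrow> w k = 1 \<or> w k = -1"
    and h: "\<And>x. x \<in> bitstrings V \<Longrightarrow> h x = C + ring_energy c M w x"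
    and k: "k < M"
  shows "real M * qaoa_mean V h \<beta> \<gamma> ms (ring_term c M w k) = qaoa_mean V h \<beta> \<gamma> ms (ring_energy c M w)"
proof -
  have "0 < M" using k by simp
  let ?s = "\<lambda>k. Suc k mod M"
  note bij_s = bij_betw_Suc_mod[OF \<open>0 < M\<close>]
  have s_less: "?s k < M" for k using \<open>0 < M\<close> by simp
  \<comment> \<open>The shift along the ring, extended by the identity to the spectators.\<close>
  define \<sigma> where "\<sigma> v = (if v \<in> c ` {..<M} then c (?s (inv_into {..<M} c v)) else v)" for v
  have \<sigma>_c: "\<sigma> (c k) = c (?s k)" if "k < M" for k
    using that inj by (simp add: \<sigma>_def inv_into_f_f)
  have "\<sigma> ` V \<subseteq> V"
  proof (rule image_subsetI)
    fix v assume "v \<in> V"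
    show "\<sigma> v \<in> V"
    proof (cases "v \<in> c ` {..<M}")
      case True
      then obtain k where "k < M" "v = c k" by auto
      then show ?thesis using \<sigma>_c[of k] s_less[of k] sub by auto
    qed (simp add: \<sigma>_def \<open>v \<in> V\<close>)
  qed
  moreover have "V \<subseteq> \<sigma> ` V"
  proof
    fix v assume "v \<in> V"
    show "v \<in> \<sigma> ` V"
    proof (cases "v \<in> c ` {..<M}")
      case True
      then obtain k where "k < M" "v = c k" by auto
      moreover obtain l where "l < M" "k = ?s l"
        using bij_betw_imp_surj_on[OF bij_s] \<open>k < M\<close> by blast
      ultimately have "v = \<sigma> (c l)" "c l \<in> V" using \<sigma>_c[of l] sub by auto
      then show ?thesis by blast
    next
      case False
      then have "\<sigma> v = v" by (simp add: \<sigma>_def)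
      then show ?thesis using \<open>v \<in> V\<close> by force
    qed
  qed
  ultimately have "\<sigma> ` V = V" by blast
  then have bij: "bij_betw \<sigma> V V"
    using V by (simp add: bij_betw_def eq_card_imp_inj_on)
  define F where "F = {c k | k. k < M \<and> w k = -1}"
  let ?T = "relabel V \<sigma> F"
  have spin_T: "spin (?T x) (c k) = w k * spin x (c (?s k))" if x: "x \<in> bitstrings V" and "k < M" for x k
  proof -
    have "c k \<in> V" "c (?s k) \<in> V" using sub that s_less[of k] by auto
    moreover have "c k \<in> F \<longleftrightarrow> w k = -1"
      using inj_onD[OF inj] \<open>k < M\<close> unfolding F_def by blast
    ultimately show ?thesis
      using bitstrings_cases[OF x, of "c (?s k)"] w[OF \<open>k < M\<close>] \<sigma>_c[OF \<open>k < M\<close>]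
      by (auto simp: relabel_def spin_def)
  qed
  have term_T: "ring_term c M w k (?T x) = ring_term c M w (?s k) x" if "x \<in> bitstrings V" "k < M" for x k
  proof -
    \<comment> \<open>One \<open>w k\<close> is the coupling, the other comes from the flip at
      \<open>c k\<close>; the flip at the next site supplies the coupling of the next edge.\<close>
    have "w k * w k = 1" using w[OF that(2)] by auto
    moreover have "ring_term c M w k (?T x) = (w k * w k) * ring_term c M w (?s k) x"
      unfolding ring_term_def spin_T[OF that] spin_T[OF that(1) s_less] by (simp only: mult_ac)
    ultimately show ?thesis by simp
  qed
  have h_T: "h (?T x) = h x" if "x \<in> bitstrings V" for x
  proof -
    have "ring_energy c M w (?T x) = (\<Sum>k<M. ring_term c M w (?s k) x)"
      unfolding ring_energy_def by (rule sum.cong) (simp_all add: term_T[OF that])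
    also have "\<dots> = ring_energy c M w x"
      unfolding ring_energy_def by (rule sum.reindex_bij_betw[OF bij_s])
    finally show ?thesis
      using h[OF that] h[of "?T x"] bij_betwE[OF bij_betw_relabel[OF V bij, of F]] that by simp
  qed
  have sym: "qaoa_mean V h \<beta> \<gamma> ms (\<lambda>x. f (?T x)) = qaoa_mean V h \<beta> \<gamma> ms f" for f
    by (rule qaoa_mean_relabel[where f = f and h = h and F = F, OF V bij h_T])
  let ?m = "\<lambda>k. qaoa_mean V h \<beta> \<gamma> ms (ring_term c M w k)"
  have shift: "?m (?s k) = ?m k" if "k < M" for k
  proof -
    have "?m (?s k) = qaoa_mean V h \<beta> \<gamma> ms (\<lambda>x. ring_term c M w k (?T x))"
      by (rule qaoa_mean_cong) (simp add: term_T that)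
    also have "\<dots> = ?m k" by (rule sym)
    finally show ?thesis .
  qed
  have m_0: "?m k = ?m 0" if "k < M" for k
    using that
  proof (induction k)
    case (Suc k)
    then show ?case using shift[of k] by simp
  qed simp
  have "qaoa_mean V h \<beta> \<gamma> ms (ring_energy c M w) = (\<Sum>k<M. ?m k)"
    unfolding ring_energy_def[abs_def] by (rule qaoa_mean_sum)
  also have "\<dots> = (\<Sum>l<M. ?m k)"
  proof (rule sum.cong)
    fix l assume "l \<in> {..<M}"
    then show "?m l = ?m k" using m_0[of l] m_0[OF k] by (metis lessThan_iff)
  qed simp
  finally show ?thesis by simp
qed

lemma ring_term_cases:
  "w k = 1 \<or> w k = -1 \<Longrightarrow> ring_term c M w k x = 1 \<or> ring_term c M w k x = -1"
  unfolding ring_term_def using spin_cases[of x "c k"] spin_cases[of x "c (Suc k mod M)"] by auto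

text \<open>Around the ring each spin occurs in exactly two terms and cancels.\<close>

lemma prod_ring_term:
  assumes "0 < M"
  shows "(\<Prod>k<M. ring_term c M w k x) = (\<Prod>k<M. w k)"
proof -
  have "(\<Prod>k<M. spin x (c (Suc k mod M))) = (\<Prod>k<M. spin x (c k))"
    by (rule prod.reindex_bij_betw[OF bij_betw_Suc_mod[OF assms]])
  moreover have "(\<Prod>k<M. spin x (c k)) * (\<Prod>k<M. spin x (c k)) = 1"
    by (simp add: prod.distrib[symmetric])
  ultimately show ?thesis
    unfolding ring_term_def by (simp add: prod.distrib)
qed

text \<open>The terms multiply to -1, so at least one of them is -1, which costs 2 against the value
  \<open>M\<close> of a fully satisfied ring.\<close>

lemma ring_energy_frustrated:
  assumes "0 < M" and w: "\<And>k. k < M \<Longrightarrow> w k = 1 \<or> w k = -1" and "(\<Prod>k<M. w k) = -1"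
  shows "ring_energy c M w x \<le> real M - 2"
proof -
  have "\<exists>k<M. ring_term c M w k x = -1"
  proof (rule ccontr)
    assume "\<not> ?thesis"
    then have "ring_term c M w k x = 1" if "k < M" for k
      using ring_term_cases[of w k c M x] w that by blast
    then have "(\<Prod>k<M. ring_term c M w k x) = 1" by simp
    then show False using prod_ring_term[OF \<open>0 < M\<close>, of c w x] assms(3) by simp
  qed
  then obtain k where k: "k < M" "ring_term c M w k x = -1" by blast
  have "(\<Sum>l\<in>{..<M} - {k}. ring_term c M w l x) \<le> (\<Sum>l\<in>{..<M} - {k}. 1)"
    proof (rule sum_mono)
    fix l assume "l \<in> {..<M} - {k}"
    then show "ring_term c M w l x \<le> 1" using ring_term_cases[of w l c M x] w[of l] by auto
  qed
  also have "\<dots> = real M - 1" using k(1) by (simp add: of_nat_diff Suc_le_eq)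
  finally show ?thesis
    unfolding ring_energy_def using sum.remove[of "{..<M}" k "\<lambda>l. ring_term c M w l x"] k by simp
qed

text \<open>The core of the QAOA bound. Edge number p is taken so that the light cone is the path on
  the vertices 0, ..., 2p + 1 and does not wrap. Its energy \<open>g\<close> is part of the cycle
  energy and of the energy of the frustrated ring. Both remainders see only spins outside {1..2p},
  which the p layers cannot detect, so the edge has the same mean in both systems.\<close>

lemma qaoa_mean_cycle_edge_le:
  assumes p: "1 \<le> p" and n: "2 * p + 2 \<le> n" and J: "\<And>k. k < n \<Longrightarrow> J k = 1 \<or> J k = -1"
    and ms: "length ms = p"
  shows "qaoa_mean {..<n} (ring_energy (\<lambda>k. k) n J) \<beta> \<gamma> ms (ring_term (\<lambda>k. k) n J p) \<le> real p / (real p + 1)"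
proof -
  define N where "N = 2 * p + 2"
  \<comment> \<open>The closing coupling, number 2p + 1, is minus the product of the others, so that
    all couplings multiply to -1.\<close>
  define w where "w k = (if k = 2 * p + 1 then - (\<Prod>l<2 * p + 1. J l) else J k)" for k
  define t where "t k x = J k * (spin x k * spin x (Suc k))" for k x
  define g where "g x = (\<Sum>k\<le>2 * p. t k x)" for x
  define S where "S i = {p - i..p + 1 + i}" for i
  let ?V = "{..<n}" and ?c = "\<lambda>k::nat. k"
  have J_prod: "(\<Prod>l<m. J l) = 1 \<or> (\<Prod>l<m. J l) = -1" if "m \<le> n" for m
    using that
  proof (induction m)
    case (Suc m)
    then show ?case using J[of m] by auto
  qed simp
  have w: "w k = 1 \<or> w k = -1" if "k < N" for k
    using J[of k] J_prod[of "2 * p + 1"] that n by (auto simp: w_def N_def)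
  have prod_w: "(\<Prod>k<N. w k) = -1"
  proof -
    have "(\<Prod>k<N. w k) = (\<Prod>l<2 * p + 1. J l) * - (\<Prod>l<2 * p + 1. J l)"
      unfolding N_def by (simp add: w_def)
    then show ?thesis using J_prod[of "2 * p + 1"] n by auto
  qed
  have spin_eq: "spin x k = spin y k" if "x k = y k" for x y :: "nat bits" and k
    using that by (simp add: spin_def)
  \<comment> \<open>The phases of the p layers meet the supports \<open>S 0\<close>, ...,
    \<open>S (p - 1)\<close>, the last of which is {1..2p}; the ends 0 and 2p + 1 of the path are
    not among them.\<close>
  have S_sub: "S i \<subseteq> {1..2 * p}" if "i < p" for i using that by (auto simp: S_def)
  have spread: "g (flip k y) - g (flip k x) = g y - g x"
    if i: "i < p" and k: "k \<in> ?V - S (Suc i)" and x: "x \<in> bitstrings ?V" and y: "y \<in> bitstrings ?V"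
      and xy: "\<And>k. k \<in> ?V - S i \<Longrightarrow> x k = y k" for i k x y
  proof -
    have "t l (flip k y) - t l (flip k x) = t l y - t l x" if l: "l \<le> 2 * p" for l
    proof (cases "l = k \<or> Suc l = k")
      case True
      \<comment> \<open>An edge at a site off \<open>S (Suc i)\<close> has both ends off
        \<open>S i\<close>, so its term agrees on x and y and contributes 0 to both
        differences.\<close>
      then have "l \<notin> S i" "Suc l \<notin> S i" using i k by (auto simp: S_def)
      then have "spin x l = spin y l" "spin x (Suc l) = spin y (Suc l)"
        using spin_eq[of x l y] spin_eq[of x "Suc l" y] xy[of l] xy[of "Suc l"] l n by auto
      with True show ?thesis
        using k by (elim disjE) (simp_all add: t_def spin_flip[OF x] spin_flip[OF y])
    next
      case False
      then show ?thesis using k by (simp add: t_def spin_flip[OF x] spin_flip[OF y])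
    qed
    then show ?thesis
      unfolding g_def sum_subtractf[symmetric] by (intro sum.cong) auto
  qed
  have mono: "S i \<subseteq> S (Suc i)" for i by (auto simp: S_def)
  have observable: "ring_term ?c n J p (flip k x) = ring_term ?c n J p x"
    if "k \<in> ?V - S 0" "x \<in> bitstrings ?V" for k x
  proof -
    have "k < n" "k \<noteq> p" "k \<noteq> Suc p" using that(1) by (auto simp: S_def)
    then show ?thesis using n by (simp add: ring_term_def spin_flip[OF that(2)])
  qed
  \<comment> \<open>A remainder \<open>R\<close> that ignores the spins 1, ..., 2p cancels in all
    the phase differences.\<close>
  have local: "qaoa_mean ?V h \<beta> \<gamma> ms (ring_term ?c n J p) = qaoa_mean ?V g \<beta> \<gamma> ms (ring_term ?c n J p)"
    if h: "\<And>x. h x = g x + R x"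
      and R: "\<And>x y. (\<And>k. k < n \<Longrightarrow> k \<notin> {1..2 * p} \<Longrightarrow> spin x k = spin y k) \<Longrightarrow> R x = R y" for h R
  proof (rule qaoa_mean_local[where S = S and p = p])
    fix i and x y :: "nat bits" assume i: "i < p" and xy: "\<And>k. k \<in> ?V - S i \<Longrightarrow> x k = y k"
    have "R x = R y"
      using S_sub[OF i] by (intro R spin_eq xy) auto
    then show "h y - h x = g y - g x" by (simp add: h)
  next
    fix i k x y
    assume "i < p" "k \<in> ?V - S (Suc i)" "x \<in> bitstrings ?V" "y \<in> bitstrings ?V"
      and "\<And>k. k \<in> ?V - S i \<Longrightarrow> x k = y k"
    then show "g (flip k y) - g (flip k x) = g y - g x" by (rule spread)
  qed (rule finite_lessThan mono observable | simp add: ms)+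
  have cycle: "qaoa_mean ?V (ring_energy ?c n J) \<beta> \<gamma> ms (ring_term ?c n J p) =
      qaoa_mean ?V g \<beta> \<gamma> ms (ring_term ?c n J p)"
  proof (rule local)
    fix x
    have split: "{..<n} = {..2 * p} \<union> {2 * p + 1..<n}" using n by auto
    have "ring_energy ?c n J x =
        (\<Sum>k\<le>2 * p. ring_term ?c n J k x) + (\<Sum>k\<in>{2 * p + 1..<n}. ring_term ?c n J k x)"
      unfolding ring_energy_def split by (rule sum.union_disjoint) auto
    also have "(\<Sum>k\<le>2 * p. ring_term ?c n J k x) = g x"
      unfolding g_def using n by (intro sum.cong) (auto simp: ring_term_def t_def)
    finally show "ring_energy ?c n J x = g x + (\<Sum>k\<in>{2 * p + 1..<n}. ring_term ?c n J k x)" .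
  next
    fix x y assume eq: "\<And>k. k < n \<Longrightarrow> k \<notin> {1..2 * p} \<Longrightarrow> spin x k = spin y k"
    have "ring_term ?c n J k x = ring_term ?c n J k y" if "k \<in> {2 * p + 1..<n}" for k
    proof -
      have "Suc k mod n < n" using that by simp
      \<comment> \<open>The wrap-around edge ends at vertex 0, which is also outside
        {1..2p}.\<close>
      have "Suc k mod n = 0 \<or> Suc k mod n = Suc k"
        using that by (cases "Suc k = n") simp_all
      then have "Suc k mod n \<notin> {1..2 * p}" using that by (elim disjE) simp_all
      then show ?thesis
        unfolding ring_term_def using that eq[of k] eq[OF \<open>Suc k mod n < n\<close>] by simp
    qed
    then show "(\<Sum>k\<in>{2 * p + 1..<n}. ring_term ?c n J k x) = (\<Sum>k\<in>{2 * p + 1..<n}. ring_term ?c n J k y)"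
      by (rule sum.cong[OF refl])
  qed
  have frustrated: "qaoa_mean ?V (ring_energy ?c N w) \<beta> \<gamma> ms (ring_term ?c n J p) =
      qaoa_mean ?V g \<beta> \<gamma> ms (ring_term ?c n J p)"
  proof (rule local)
    fix x
    have "{..<N} = insert (2 * p + 1) {..2 * p}" by (auto simp: N_def)
    then have "ring_energy ?c N w x = ring_term ?c N w (2 * p + 1) x + (\<Sum>k\<le>2 * p. ring_term ?c N w k x)"
      unfolding ring_energy_def by simp
    also have "(\<Sum>k\<le>2 * p. ring_term ?c N w k x) = g x"
      unfolding g_def by (intro sum.cong) (auto simp: ring_term_def t_def w_def N_def)
    finally show "ring_energy ?c N w x = g x + w (2 * p + 1) * (spin x (2 * p + 1) * spin x 0)"
      by (simp add: ring_term_def N_def)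
  next
    fix x y assume eq: "\<And>k. k < n \<Longrightarrow> k \<notin> {1..2 * p} \<Longrightarrow> spin x k = spin y k"
    show "w (2 * p + 1) * (spin x (2 * p + 1) * spin x 0) = w (2 * p + 1) * (spin y (2 * p + 1) * spin y 0)"
      using eq[of "2 * p + 1"] eq[of 0] n by simp
  qed
  have N: "N \<le> n" "0 < N" "p < N" using n by (simp_all add: N_def)
  have same_term: "ring_term ?c n J p = ring_term ?c N w p"
    using n p by (simp add: fun_eq_iff ring_term_def N_def w_def)
  have "real N * qaoa_mean ?V (ring_energy ?c n J) \<beta> \<gamma> ms (ring_term ?c n J p) =
      real N * qaoa_mean ?V (ring_energy ?c N w) \<beta> \<gamma> ms (ring_term ?c N w p)"
    using cycle frustrated unfolding same_term by (simp only:)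
  also have "\<dots> = qaoa_mean ?V (ring_energy ?c N w) \<beta> \<gamma> ms (ring_energy ?c N w)"
  proof (rule qaoa_mean_ring_term)
    show "ring_energy ?c N w x = 0 + ring_energy ?c N w x" for x by simp
    show "(\<lambda>k. k) ` {..<N} \<subseteq> ?V" using N by auto
  qed (simp_all add: w N)
  also have "\<dots> \<le> real N - 2"
    by (rule qaoa_mean_le) (simp_all add: ring_energy_frustrated N w prod_w)
  \<comment> \<open>With \<open>N = 2 * p + 2\<close> the quotient (N - 2) / N is p / (p +
    1).\<close>
  finally show ?thesis by (simp add: N_def field_simps)
qed

section \<open>Elimination of a variable\<close>

definition ising_energy :: "'v ising \<Rightarrow> 'v bits \<Rightarrow> real" where
  "ising_energy I x = (\<Sum>e\<in>edges I. weight I e * (\<Prod>k\<in>e. spin x k)) + const_term I"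

lemma ising_ham_eq_diag_op: "ising_ham I = diag_op (ising_energy I)"
  unfolding ising_ham_def diag_op_def ising_energy_def pauliZ_prod_def
  by (intro ext) (simp add: sum_distrib_right distrib_right mult.assoc)

lemma cycle_ham_eq_diag_op: "cycle_ham n J = diag_op (ring_energy (\<lambda>k. k) n J)"
  unfolding cycle_ham_def diag_op_def ring_energy_def ring_term_def pauliZ_def
  by (intro ext) (simp add: sum_distrib_right mult.assoc)

lemma qaoa1_optimal_iff:
  assumes "finite (verts I)"
  shows "qaoa1_optimal I b g \<longleftrightarrow> (\<forall>b' g'. level1_energy (verts I) (ising_energy I) b' g'
    \<le> level1_energy (verts I) (ising_energy I) b g)"
  unfolding qaoa1_optimal_def ising_ham_eq_diag_op expval_qaoa_state[OF assms] by simp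

lemma correlation_eq_mean:
  assumes "finite (verts I)"
  shows "correlation I b g i j = qaoa_mean (verts I) (ising_energy I) (\<lambda>_. b) (\<lambda>_. g) [1]
    (\<lambda>x. spin x i * spin x j)"
proof -
  have "pauliZ i \<circ> pauliZ j = diag_op (\<lambda>x. spin x i * spin x j)"
    by (simp add: fun_eq_iff pauliZ_def diag_op_def)
  then show ?thesis
    unfolding correlation_def ising_ham_eq_diag_op by (simp add: expval_qaoa_state[OF assms])
qed

lemma verts_eliminate [simp]: "verts (eliminate i j s I) = verts I - {j}"
  by (simp add: eliminate_def Let_def)

text \<open>The new weights are sums over the fibres of \<open>redirect\<close>, so regrouping turns
  the new energy into a sum over the old edges, even where edges have merged. There the constraint
  matches the terms one by one, and the edge {i, j} has become the constant.\<close>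

lemma ising_energy_eliminate:
  assumes fin: "finite (edges I)" and edges: "\<And>e. e \<in> edges I \<Longrightarrow> e \<subseteq> verts I \<and> card e = 2"
    and ij: "{i, j} \<in> edges I" "i \<noteq> j" and x: "spin x j = s * spin x i" and s: "s * s = 1"
  shows "ising_energy (eliminate i j s I) (restrict x (verts I - {j})) = ising_energy I x"
proof -
  define R where "R = edges I - {{i, j}}"
  define y where "y = restrict x (verts I - {j})"
  have finR: "finite R" using fin by (simp add: R_def)
  have y: "spin y k = spin x k" if "k \<in> verts I" "k \<noteq> j" for k
    using that by (simp add: y_def spin_def)
  have iV: "i \<in> verts I" using edges[OF ij(1)] by auto
  have edge: "(if j \<in> e then s else 1) * weight I e * (\<Prod>k\<in>redirect i j e. spin y k) =
      weight I e * (\<Prod>k\<in>e. spin x k)" if "e \<in> R" for e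
  proof -
    have e: "e \<subseteq> verts I" "card e = 2" "e \<noteq> {i, j}" using that edges by (auto simp: R_def)
    then have fe: "finite e" using card.infinite by fastforce
    show ?thesis
    proof (cases "j \<in> e")
      case True
      then obtain k where k: "e = {j, k}" "k \<noteq> j"
        using e(2) by (auto simp: card_2_iff doubleton_eq_iff)
      \<comment> \<open>Otherwise e would be the removed edge, whose redirection would shrink to
        {i}.\<close>
      have "k \<noteq> i" using k e(3) by (auto simp: insert_commute)
      moreover have "k \<in> verts I" using k(1) e(1) by simp
      moreover have "redirect i j e = {i, k}" using k by (auto simp: redirect_def)
      ultimately show ?thesis
        using k ij(2) iV y[of i] y[of k] by (simp add: x mult_ac)
    next
      case False
      then show ?thesis
        using e(1) y by (auto simp: redirect_def intro!: prod.cong)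
    qed
  qed
  have "ising_energy (eliminate i j s I) y = (\<Sum>e'\<in>redirect i j ` R. (\<Sum>e\<in>{e \<in> R. redirect i j e = e'}.
      (if j \<in> e then s else 1) * weight I e) * (\<Prod>k\<in>e'. spin y k)) + (const_term I + s * weight I {i, j})"
    by (simp add: ising_energy_def eliminate_def Let_def R_def)
  also have "(\<Sum>e'\<in>redirect i j ` R. (\<Sum>e\<in>{e \<in> R. redirect i j e = e'}.
      (if j \<in> e then s else 1) * weight I e) * (\<Prod>k\<in>e'. spin y k)) =
      (\<Sum>e'\<in>redirect i j ` R. \<Sum>e\<in>{e \<in> R. redirect i j e = e'}.
        (if j \<in> e then s else 1) * weight I e * (\<Prod>k\<in>redirect i j e. spin y k))"
    unfolding sum_distrib_right by (intro sum.cong refl) auto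
  also have "\<dots> = (\<Sum>e\<in>R. (if j \<in> e then s else 1) * weight I e * (\<Prod>k\<in>redirect i j e. spin y k))"
    by (rule sum.image_gen[OF finR, symmetric])
  also have "\<dots> = (\<Sum>e\<in>R. weight I e * (\<Prod>k\<in>e. spin x k))"
    by (rule sum.cong[OF refl], rule edge)
  also have "(\<Sum>e\<in>R. weight I e * (\<Prod>k\<in>e. spin x k)) + (const_term I + s * weight I {i, j}) = ising_energy I x"
  proof -
    have "(\<Prod>k\<in>{i, j}. spin x k) = s"
      using ij(2) x by (simp add: mult.left_commute)
    then show ?thesis
      unfolding ising_energy_def R_def using sum.remove[OF fin ij(1), of "\<lambda>e. weight I e * (\<Prod>k\<in>e. spin x k)"] by (simp add: mult.commute)
  qed
  finally show ?thesis unfolding y_def .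
qed

lemma ex_bits_extension:
  assumes y: "y \<in> bitstrings (V - {j})" and j: "j \<in> V" and i: "i \<in> V" "i \<noteq> j" and s: "s = 1 \<or> s = -1"
  shows "\<exists>x\<in>bitstrings V. restrict x (V - {j}) = y \<and> spin x j = s * spin x i"
proof -
  define x where "x = y(j := (if s = 1 then y i else 1 - y i))"
  have yi: "y i = 0 \<or> y i = 1" using bitstrings_cases[OF y] i by blast
  have "x \<in> bitstrings V"
    unfolding bitstrings_def
  proof (rule PiE_I)
    fix k assume "k \<in> V"
    then show "x k \<in> {0, 1}" using yi bitstrings_cases[OF y, of k] by (auto simp: x_def)
  next
    fix k assume "k \<notin> V"
    then show "x k = undefined" using y j by (auto simp: x_def bitstrings_def PiE_iff extensional_def)
  qed
  moreover have "restrict x (V - {j}) = y"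
    using y by (auto simp: x_def fun_eq_iff restrict_def bitstrings_def PiE_iff extensional_def)
  moreover have "spin x j = s * spin x i"
    using s yi i by (auto simp: x_def spin_def)
  ultimately show ?thesis by blast
qed

lemma restrict_bitstrings: "x \<in> bitstrings V \<Longrightarrow> restrict x (V - {j}) \<in> bitstrings (V - {j})"
  unfolding bitstrings_def by (auto simp: PiE_iff)

text \<open>A constraint costs nothing if one maximizer satisfies it, because the old and the new
  energy agree on all assignments that do.\<close>

lemma is_maximizer_eliminate:
  assumes finV: "finite (verts I)"
    and fin: "finite (edges I)" and edges: "\<And>e. e \<in> edges I \<Longrightarrow> e \<subseteq> verts I \<and> card e = 2"
    and ij: "{i, j} \<in> edges I" "i \<noteq> j" and s: "s = 1 \<or> s = -1"
    and max: "is_maximizer (verts I) (ising_ham I) x\<^sub>0" "spin x\<^sub>0 j = s * spin x\<^sub>0 i"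
    and y: "is_maximizer (verts (eliminate i j s I)) (ising_ham (eliminate i j s I)) (restrict x (verts I - {j}))"
    and x: "x \<in> bitstrings (verts I)" "spin x j = s * spin x i"
  shows "is_maximizer (verts I) (ising_ham I) x"
proof -
  have ss: "s * s = 1" using s by auto
  have energy: "ising_energy (eliminate i j s I) (restrict x (verts I - {j})) = ising_energy I x"
    if "spin x j = s * spin x i" for x
    by (rule ising_energy_eliminate[OF fin _ ij that ss]) (rule edges)
  have finV': "finite (verts (eliminate i j s I))" using finV by simp
  have x0: "x\<^sub>0 \<in> bitstrings (verts I)" "\<And>y. y \<in> bitstrings (verts I) \<Longrightarrow> ising_energy I y \<le> ising_energy I x\<^sub>0"
    using max(1) unfolding ising_ham_eq_diag_op is_maximizer_diag_op[OF finV] by blast+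
  have "ising_energy I x\<^sub>0 = ising_energy (eliminate i j s I) (restrict x\<^sub>0 (verts I - {j}))"
    by (rule energy[symmetric]) (fact max(2))
  also have "\<dots> \<le> ising_energy (eliminate i j s I) (restrict x (verts I - {j}))"
    using y restrict_bitstrings[OF x0(1)]
    unfolding ising_ham_eq_diag_op is_maximizer_diag_op[OF finV'] by simp
  also have "\<dots> = ising_energy I x"
    by (rule energy) (fact x(2))
  finally show ?thesis
    unfolding ising_ham_eq_diag_op is_maximizer_diag_op[OF finV] using x(1) x0(2) order_trans by blast
qed

section \<open>Unfrustrated rings\<close>

lemma cycle_edge_subset: "k < M \<Longrightarrow> cycle_edge M k \<subseteq> {..<M}"
  by (auto simp: cycle_edge_def)

lemma Suc_mod_neq: "2 \<le> M \<Longrightarrow> k < M \<Longrightarrow> Suc k mod M \<noteq> k"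
  by (cases "Suc k = M") auto

text \<open>If two edges coincided in opposite orientations, two steps would lead back to the start
  and M would divide 2. This is why rings begin at three vertices.\<close>

lemma inj_on_cycle_edge: "3 \<le> M \<Longrightarrow> inj_on (cycle_edge M) {..<M}"
proof (rule inj_onI)
  fix k l assume M: "3 \<le> M" and kl: "k \<in> {..<M}" "l \<in> {..<M}" "cycle_edge M k = cycle_edge M l"
  show "k = l"
  proof (rule ccontr)
    assume "k \<noteq> l"
    with kl(3) have "k = Suc l mod M" "Suc k mod M = l"
      by (auto simp: cycle_edge_def doubleton_eq_iff)
    then have "Suc (Suc l) mod M = l" by (simp add: mod_Suc_eq)
    moreover have "Suc (Suc l) mod M = (if Suc (Suc l) < M then Suc (Suc l) else Suc (Suc l) - M)"
      using M kl(2) by (simp add: mod_if)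
    ultimately show False using M kl(2) by (simp split: if_splits)
  qed
qed

text \<open>Couplings \<open>z i * z j\<close> are those of a ferromagnetic ring up to a gauge
  transformation. As z is attached to the vertices, every elimination keeps this form with the same
  z. The integral constant keeps the energies integral, hence periodic in the angles.\<close>

definition unfrustrated_ring :: "('v \<Rightarrow> real) \<Rightarrow> (nat \<Rightarrow> 'v) \<Rightarrow> nat \<Rightarrow> 'v ising \<Rightarrow> bool" where
  "unfrustrated_ring z c M I \<longleftrightarrow> 3 \<le> M \<and> inj_on c {..<M} \<and> verts I = c ` {..<M} \<and>
     edges I = (\<lambda>k. c ` cycle_edge M k) ` {..<M} \<and>
     (\<forall>e\<in>edges I. weight I e = (\<Prod>v\<in>e. z v)) \<and>
     (\<forall>v\<in>verts I. z v = 1 \<or> z v = -1) \<and> const_term I \<in> \<int>"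

locale ring_instance =
  fixes z :: "'v \<Rightarrow> real" and c :: "nat \<Rightarrow> 'v" and M :: nat and I :: "'v ising"
  assumes ring: "unfrustrated_ring z c M I"
begin

lemma M_ge: "3 \<le> M" and inj_c: "inj_on c {..<M}" and verts: "verts I = c ` {..<M}"
  and edges: "edges I = (\<lambda>k. c ` cycle_edge M k) ` {..<M}"
  and weight: "\<And>e. e \<in> edges I \<Longrightarrow> weight I e = (\<Prod>v\<in>e. z v)"
  and z_cases: "\<And>v. v \<in> verts I \<Longrightarrow> z v = 1 \<or> z v = -1"
  and const_int: "const_term I \<in> \<int>"
  using ring unfolding unfrustrated_ring_def by simp_all

lemma finite_verts: "finite (verts I)" and finite_edges: "finite (edges I)"
  by (simp_all add: verts edges)

lemma card_verts: "card (verts I) = M"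
  using inj_c by (simp add: verts card_image)

lemma c_in_verts: "k < M \<Longrightarrow> c k \<in> verts I"
  by (simp add: verts)

lemma mod_less: "Suc k mod M < M"
  using M_ge by simp

lemma image_cycle_edge: "c ` cycle_edge M k = {c k, c (Suc k mod M)}"
  by (simp add: cycle_edge_def)

lemma c_next_neq: "k < M \<Longrightarrow> c (Suc k mod M) \<noteq> c k"
  using inj_on_eq_iff[OF inj_c, of "Suc k mod M" k] Suc_mod_neq[of M k] M_ge by simp

lemma inj_on_edge: "inj_on (\<lambda>k. c ` cycle_edge M k) {..<M}"
proof (rule inj_onI)
  fix k l assume "k \<in> {..<M}" "l \<in> {..<M}" "c ` cycle_edge M k = c ` cycle_edge M l"
  moreover from this have "cycle_edge M k = cycle_edge M l"
    using inj_on_image_eq_iff[OF inj_c cycle_edge_subset cycle_edge_subset, of k l] by simp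
  ultimately show "k = l" using inj_on_cycle_edge[OF M_ge] by (blast dest: inj_onD)
qed

lemma edgeE:
  assumes "{i, j} \<in> edges I"
  obtains k where "k < M" "i = c k" "j = c (Suc k mod M)" | k where "k < M" "j = c k" "i = c (Suc k mod M)"
proof -
  from assms obtain k where k: "k < M" and "{i, j} = {c k, c (Suc k mod M)}"
    unfolding edges image_cycle_edge by blast
  then have "i = c k \<and> j = c (Suc k mod M) \<or> i = c (Suc k mod M) \<and> j = c k"
    by (simp only: doubleton_eq_iff)
  then show thesis using that k by blast
qed

lemma edge_neq: "{i, j} \<in> edges I \<Longrightarrow> i \<noteq> j"
  by (elim edgeE) (simp_all add: c_next_neq c_next_neq[symmetric])

lemma edge_in_verts: "{i, j} \<in> edges I \<Longrightarrow> i \<in> verts I \<and> j \<in> verts I"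
  by (elim edgeE) (simp_all add: c_in_verts mod_less)

lemma edge_subset: "e \<in> edges I \<Longrightarrow> e \<subseteq> verts I \<and> card e = 2"
proof -
  assume "e \<in> edges I"
  then obtain k where "k < M" "e = {c k, c (Suc k mod M)}"
    unfolding edges image_cycle_edge by blast
  then show ?thesis using c_in_verts mod_less c_next_neq[of k] by simp
qed

definition w where "w k = z (c k) * z (c (Suc k mod M))"

lemma w_cases: "k < M \<Longrightarrow> w k = 1 \<or> w k = -1"
  using z_cases[OF c_in_verts, of k] z_cases[OF c_in_verts[OF mod_less], of k] by (auto simp: w_def)

lemma energy: "ising_energy I x = const_term I + ring_energy c M w x"
proof -
  have "(\<Sum>e\<in>edges I. weight I e * (\<Prod>v\<in>e. spin x v)) = (\<Sum>e\<in>edges I. (\<Prod>v\<in>e. z v) * (\<Prod>v\<in>e. spin x v))"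
    by (rule sum.cong) (simp_all add: weight)
  also have "\<dots> = (\<Sum>k<M. (\<Prod>v\<in>c ` cycle_edge M k. z v) * (\<Prod>v\<in>c ` cycle_edge M k. spin x v))"
    unfolding edges by (simp add: sum.reindex[OF inj_on_edge])
  also have "\<dots> = ring_energy c M w x"
    unfolding ring_energy_def ring_term_def image_cycle_edge
    by (rule sum.cong) (simp_all add: w_def c_next_neq[symmetric])
  finally show ?thesis by (simp add: ising_energy_def)
qed

lemma energy_int: "ising_energy I x \<in> \<int>"
proof -
  have "ring_term c M w k x \<in> \<int>" if "k < M" for k
    using ring_term_cases[of w k c M x, OF w_cases[OF that]] by auto
  then show ?thesis
    unfolding energy ring_energy_def using const_int by (intro Ints_add Ints_sum) auto
qed

definition x_opt where "x_opt = (\<lambda>v\<in>verts I. if z v = -1 then 1 else 0 :: nat)"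

lemma x_opt_bits: "x_opt \<in> bitstrings (verts I)"
  by (auto simp: x_opt_def bitstrings_def)

lemma spin_x_opt: "v \<in> verts I \<Longrightarrow> spin x_opt v = z v"
  using z_cases by (auto simp: x_opt_def spin_def)

lemma ring_term_x_opt: "k < M \<Longrightarrow> ring_term c M w k x_opt = 1"
  using z_cases[OF c_in_verts, of k] z_cases[OF c_in_verts[OF mod_less], of k]
  by (auto simp: ring_term_def w_def spin_x_opt c_in_verts mod_less)

lemma ring_term_le: "k < M \<Longrightarrow> ring_term c M w k x \<le> 1"
  using ring_term_cases[of w k c M x] w_cases[of k] by auto

lemma x_opt_maximizer: "is_maximizer (verts I) (ising_ham I) x_opt"
proof -
  have "ring_energy c M w y \<le> ring_energy c M w x_opt" for y
    unfolding ring_energy_def by (rule sum_mono) (simp add: ring_term_x_opt ring_term_le)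
  then show ?thesis
    unfolding ising_ham_eq_diag_op is_maximizer_diag_op[OF finite_verts] energy
    using x_opt_bits by simp
qed

lemma ring_term_flip:
  assumes "x \<in> bitstrings (verts I)" "k < M"
  shows "ring_term c M w k (flip (c k) x) = - ring_term c M w k x"
  unfolding ring_term_def spin_flip[OF assms(1) c_in_verts[OF assms(2)]]
  using c_next_neq[OF assms(2)] by simp

text \<open>A flip at \<open>c k\<close> negates the term of edge k, so each edge averages to zero
  and the mean of the whole energy is its constant term.\<close>

lemma sum_ring_energy: "(\<Sum>x\<in>bitstrings (verts I). ring_energy c M w x) = 0"
proof -
  have "(\<Sum>x\<in>bitstrings (verts I). ring_term c M w k x) = 0" if "k < M" for k
  proof -
    have "(\<Sum>x\<in>bitstrings (verts I). ring_term c M w k x) =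
        (\<Sum>x\<in>bitstrings (verts I). ring_term c M w k (flip (c k) x))"
      by (rule sum_flip[OF c_in_verts[OF that], symmetric])
    also have "\<dots> = - (\<Sum>x\<in>bitstrings (verts I). ring_term c M w k x)"
      unfolding sum_negf[symmetric] by (rule sum.cong) (simp_all add: ring_term_flip that)
    finally show ?thesis by simp
  qed
  then show ?thesis
    unfolding ring_energy_def by (subst sum.swap) simp
qed

lemma level1_energy_gt_const:
  assumes "\<And>b' g'. level1_energy (verts I) (ising_energy I) b' g' \<le> level1_energy (verts I) (ising_energy I) b g"
  shows "const_term I < level1_energy (verts I) (ising_energy I) b g"
proof -
  \<comment> \<open>A flip away from the optimum is the energy change that
    \<open>level1_energy_exceeds_mean\<close> asks for.\<close>
  let ?x = "flip (c 0) x_opt"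
  have "0 < M" using M_ge by simp
  have "ring_energy c M w ?x < ring_energy c M w x_opt"
    unfolding ring_energy_def
  proof (rule sum_strict_mono_ex1)
    show "\<forall>k\<in>{..<M}. ring_term c M w k ?x \<le> ring_term c M w k x_opt"
      by (simp add: ring_term_le ring_term_x_opt)
    show "\<exists>k\<in>{..<M}. ring_term c M w k ?x < ring_term c M w k x_opt"
      using \<open>0 < M\<close> ring_term_flip[OF x_opt_bits, of 0] by (intro bexI[of _ 0]) (simp_all add: ring_term_x_opt)
  qed simp
  then have "ising_energy I ?x \<noteq> ising_energy I x_opt" by (simp add: energy)
  from level1_energy_exceeds_mean[OF finite_verts x_opt_bits c_in_verts[OF \<open>0 < M\<close>] this]
  obtain b' g' where "(\<Sum>x\<in>bitstrings (verts I). ising_energy I x) / 2 ^ card (verts I) <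
      level1_energy (verts I) (ising_energy I) b' g'" by blast
  moreover have "(\<Sum>x\<in>bitstrings (verts I). ising_energy I x) / 2 ^ card (verts I) = const_term I"
    by (simp add: energy sum.distrib sum_ring_energy card_bitstrings finite_verts)
  ultimately show ?thesis using assms[of b' g'] by linarith
qed

text \<open>\<open>D\<close> is the common mean of the edge terms: by symmetry the M edges share
  equally the excess of the optimal energy over the constant, and that excess is positive. Hence all
  correlations have one modulus, which covers every way of breaking ties, and each has the sign of
  its coupling.\<close>

lemma correlation_optimal:
  assumes "qaoa1_optimal I b g"
  shows "\<exists>D>0. \<forall>i j. {i, j} \<in> edges I \<longrightarrow> correlation I b g i j = z i * z j * D"
proof -
  let ?mean = "qaoa_mean (verts I) (ising_energy I) (\<lambda>_. b) (\<lambda>_. g) [1]"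
  define D where "D = ?mean (ring_energy c M w) / M"
  have "level1_energy (verts I) (ising_energy I) b g = ?mean (\<lambda>x. const_term I + ring_energy c M w x)"
    by (rule qaoa_mean_cong) (rule energy)
  also have "\<dots> = const_term I + ?mean (ring_energy c M w)"
    unfolding qaoa_mean_add qaoa_mean_const[OF finite_verts] ..
  finally have "0 < ?mean (ring_energy c M w)"
    using level1_energy_gt_const[of b g] assms unfolding qaoa1_optimal_iff[OF finite_verts] by auto
  then have "D > 0" using M_ge by (simp add: D_def)
  moreover have corr: "?mean (\<lambda>x. spin x (c k) * spin x (c (Suc k mod M))) = z (c k) * z (c (Suc k mod M)) * D"
    if "k < M" for k
  proof -
    have "real M * ?mean (ring_term c M w k) = ?mean (ring_energy c M w)"
      using w_cases energy verts
      by (intro qaoa_mean_ring_term[OF finite_verts inj_c _ _ _ that, where C = "const_term I"]) simp_all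
    then have "?mean (ring_term c M w k) = D" using M_ge by (simp add: D_def field_simps)
    moreover have "w k * w k = 1" using w_cases[OF that] by auto
    then have "?mean (\<lambda>x. spin x (c k) * spin x (c (Suc k mod M))) = ?mean (\<lambda>x. w k * ring_term c M w k x)"
      by (intro qaoa_mean_cong) (simp add: ring_term_def mult.assoc[symmetric])
    ultimately show ?thesis
      unfolding qaoa_mean_cmult by (simp add: w_def)
  qed
  have "correlation I b g i j = z i * z j * D" if "{i, j} \<in> edges I" for i j
    unfolding correlation_eq_mean[OF finite_verts] using that
  proof (cases rule: edgeE)
    case (1 k)
    then show "?mean (\<lambda>x. spin x i * spin x j) = z i * z j * D" using corr[of k] by simp
  next
    case (2 k)
    then have "(\<lambda>x. spin x i * spin x j) = (\<lambda>x. spin x (c k) * spin x (c (Suc k mod M)))"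
      by (simp add: fun_eq_iff mult.commute)
    then show "?mean (\<lambda>x. spin x i * spin x j) = z i * z j * D"
      using corr[OF 2(1)] 2(2,3) by (simp only: mult.commute[of "z (c (Suc k mod M))"])
  qed
  ultimately show ?thesis by blast
qed

lemma optimal_exists: "\<exists>b g. qaoa1_optimal I b g"
  unfolding qaoa1_optimal_iff[OF finite_verts] by (rule level1_energy_max_exists) (rule energy_int)

lemma edge_sign:
  assumes "{i, j} \<in> edges I"
  shows "z i * z j = 1 \<or> z i * z j = -1"
  using z_cases[of i] z_cases[of j] edge_in_verts[OF assms] by auto

lemma sgn_correlation:
  assumes "qaoa1_optimal I b g" "{i, j} \<in> edges I"
  shows "sgn (correlation I b g i j) = z i * z j"
  using correlation_optimal[OF assms(1)] assms(2) edge_sign[OF assms(2)] by (auto simp: sgn_mult)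

lemma abs_correlation_eq:
  assumes "qaoa1_optimal I b g" "{i, j} \<in> edges I" "{k, l} \<in> edges I"
  shows "\<bar>correlation I b g k l\<bar> = \<bar>correlation I b g i j\<bar>"
  using correlation_optimal[OF assms(1)] assms(2,3) edge_sign[OF assms(2)] edge_sign[OF assms(3)]
  by (auto simp: abs_mult)

section \<open>Re-enumerations of a ring\<close>

lemma reindex:
  assumes \<pi>: "bij_betw \<pi> {..<M} {..<M}" and edge: "\<And>k. k < M \<Longrightarrow> \<exists>l<M. \<pi> ` cycle_edge M k = cycle_edge M l"
  shows "unfrustrated_ring z (\<lambda>k. c (\<pi> k)) M I"
proof -
  \<comment> \<open>By counting it is enough that edges go to edges: an injective map of a finite
    set into itself is onto.\<close>
  have "(`) \<pi> ` cycle_edge M ` {..<M} = cycle_edge M ` {..<M}"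
  proof (rule card_subset_eq)
    show "(`) \<pi> ` cycle_edge M ` {..<M} \<subseteq> cycle_edge M ` {..<M}"
    proof
      fix e assume "e \<in> (`) \<pi> ` cycle_edge M ` {..<M}"
      then obtain k where "k < M" "e = \<pi> ` cycle_edge M k" by auto
      with edge[of k] show "e \<in> cycle_edge M ` {..<M}" by auto
    qed
    have "inj_on ((`) \<pi>) (cycle_edge M ` {..<M})"
    proof (rule inj_onI)
      fix e e' assume "e \<in> cycle_edge M ` {..<M}" "e' \<in> cycle_edge M ` {..<M}" "\<pi> ` e = \<pi> ` e'"
      moreover from this have "e \<subseteq> {..<M}" "e' \<subseteq> {..<M}" using cycle_edge_subset by auto
      ultimately show "e = e'"
        using inj_on_image_eq_iff[OF bij_betw_imp_inj_on[OF \<pi>], of e e'] by simp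
    qed
    then show "card ((`) \<pi> ` cycle_edge M ` {..<M}) = card (cycle_edge M ` {..<M})"
      by (rule card_image)
  qed simp
  then have "(`) c ` (`) \<pi> ` cycle_edge M ` {..<M} = (`) c ` cycle_edge M ` {..<M}"
    by (rule arg_cong)
  then have "(\<lambda>k. (\<lambda>k. c (\<pi> k)) ` cycle_edge M k) ` {..<M} = edges I"
    unfolding edges image_image .
  moreover have "(\<lambda>k. c (\<pi> k)) ` {..<M} = verts I"
    using arg_cong[OF bij_betw_imp_surj_on[OF \<pi>], of "(`) c"] unfolding verts image_image .
  moreover have "inj_on (\<lambda>k. c (\<pi> k)) {..<M}"
    using comp_inj_on[of \<pi> "{..<M}" c] \<pi> inj_c by (simp add: bij_betw_def comp_def)
  ultimately show ?thesis
    unfolding unfrustrated_ring_def using M_ge weight z_cases const_int by simp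
qed

lemma rotate: "unfrustrated_ring z (\<lambda>k. c ((k + a) mod M)) M I"
proof (rule reindex)
  show "bij_betw (\<lambda>k. (k + a) mod M) {..<M} {..<M}"
  proof (induction a)
    case 0
    show ?case by (rule bij_betw_cong[THEN iffD2, OF _ bij_betw_id]) simp
  next
    case (Suc a)
    have "bij_betw ((\<lambda>k. Suc k mod M) \<circ> (\<lambda>k. (k + a) mod M)) {..<M} {..<M}"
      using Suc bij_betw_Suc_mod[of M] M_ge by (intro bij_betw_trans) auto
    moreover have "(\<lambda>k. Suc k mod M) \<circ> (\<lambda>k. (k + a) mod M) = (\<lambda>k. (k + Suc a) mod M)"
      by (simp add: fun_eq_iff mod_Suc_eq)
    ultimately show ?case by simp
  qed
  fix k assume "k < M"
  have "(Suc k mod M + a) mod M = Suc ((k + a) mod M) mod M"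
    by (simp add: mod_Suc_eq mod_add_left_eq)
  then show "\<exists>l<M. (\<lambda>k. (k + a) mod M) ` cycle_edge M k = cycle_edge M l"
    using M_ge by (intro exI[of _ "(k + a) mod M"]) (simp add: cycle_edge_def)
qed

lemma reflect: "unfrustrated_ring z (\<lambda>k. c (M - 1 - k)) M I"
proof (rule reindex)
  show "bij_betw (\<lambda>k. M - 1 - k) {..<M} {..<M}"
    by (rule bij_betw_byWitness[of _ "\<lambda>k. M - 1 - k"]) auto
  fix k assume k: "k < M"
  show "\<exists>l<M. (\<lambda>k. M - 1 - k) ` cycle_edge M k = cycle_edge M l"
  proof (cases "Suc k = M")
    case True
    then show ?thesis
      using M_ge by (intro exI[of _ "M - 1"]) (auto simp: cycle_edge_def)
  next
    case False
    then have "Suc k < M" using k by simp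
    moreover from this have "Suc (M - 2 - k) = M - 1 - k" "M - 1 - Suc k = M - 2 - k" by simp_all
    ultimately show ?thesis
      using M_ge by (intro exI[of _ "M - 2 - k"]) (simp add: cycle_edge_def insert_commute)
  qed
qed

end

text \<open>With the eliminated vertex placed last and its partner at 0, the same enumeration cut at
  \<open>M - 1\<close> describes the ring that is left. The reflection covers an edge met in the
  other direction.\<close>

lemma unfrustrated_ring_normalize:
  assumes "unfrustrated_ring z c M I" "{i, j} \<in> edges I"
  shows "\<exists>c'. unfrustrated_ring z c' M I \<and> c' 0 = i \<and> c' (M - 1) = j"
proof -
  interpret ring_instance z c M I by unfold_locales (fact assms(1))
  have M: "M - 1 + Suc k = k + M" for k using M_ge by simp
  from assms(2) show ?thesis
  proof (cases rule: edgeE)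
    case (1 k)
    interpret rot: ring_instance z "\<lambda>m. c ((m + Suc k) mod M)" M I
      by unfold_locales (rule rotate)
    show ?thesis
      using rot.reflect 1 M_ge M[of k]
      by (intro exI[of _ "\<lambda>m. c ((M - 1 - m + Suc k) mod M)"]) simp
  next
    case (2 k)
    then show ?thesis
      using rotate[of "Suc k"] M_ge M[of k] by (intro exI[of _ "\<lambda>m. c ((m + Suc k) mod M)"]) simp
  qed
qed

text \<open>Only the edge between \<open>c (N - 1)\<close> and j is redirected, to i; since z j
  squares to 1, its new weight is again the product of z over its ends. At least three remaining
  vertices keep the redirected edges distinct, so no weights are added up. The constant grows by 1,
  the eliminated coupling being satisfied.\<close>

lemma unfrustrated_ring_eliminate:
  assumes "unfrustrated_ring z c (Suc N) I" "3 \<le> N" "{i, j} \<in> edges I"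
  shows "\<exists>c'. unfrustrated_ring z c' N (eliminate i j (z i * z j) I)"
proof -
  from unfrustrated_ring_normalize[OF assms(1,3)] obtain c
    where ring_c: "unfrustrated_ring z c (Suc N) I" and i: "i = c 0" and j: "j = c N" by auto
  interpret ring_instance z c "Suc N" I by unfold_locales (fact ring_c)
  let ?s = "z i * z j" and ?I' = "eliminate i j (z i * z j) I"
  let ?e = "\<lambda>k. c ` cycle_edge (Suc N) k" and ?e' = "\<lambda>k. c ` cycle_edge N k"
  define R where "R = edges I - {{i, j}}"
  have c_eq: "c k = c l \<longleftrightarrow> k = l" if "k \<le> N" "l \<le> N" for k l
    using inj_onD[OF inj_c, of k l] that by auto
  have inj_c': "inj_on c {..<N}" using inj_c by (rule inj_on_subset) auto
  have inj_e': "inj_on ?e' {..<N}"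
  proof (rule inj_onI)
    fix k l assume "k \<in> {..<N}" "l \<in> {..<N}" "?e' k = ?e' l"
    moreover from this have "cycle_edge N k = cycle_edge N l"
      using inj_on_image_eq_iff[OF inj_c' cycle_edge_subset cycle_edge_subset, of k l] by simp
    ultimately show "k = l" using inj_on_cycle_edge[OF assms(2)] by (blast dest: inj_onD)
  qed
  have "{{i, j}} = ?e ` {N}" unfolding image_insert image_cycle_edge i j by auto
  then have "R = ?e ` {..<Suc N} - ?e ` {N}" unfolding R_def edges by (simp only:)
  also have "\<dots> = ?e ` ({..<Suc N} - {N})"
    by (rule inj_on_image_set_diff[OF inj_on_edge, symmetric]) auto
  also have "{..<Suc N} - {N} = {..<N}" by auto
  finally have R: "R = ?e ` {..<N}" .
  have e: "?e k = (if Suc k < N then ?e' k else {c (N - 1), j})" if "k < N" for k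
    using that by (cases "Suc k = N") (auto simp: cycle_edge_def j)
  have e'_last: "?e' (N - 1) = {c (N - 1), i}" using assms(2) by (simp add: cycle_edge_def i)
  have j_in: "j \<in> ?e k \<longleftrightarrow> Suc k = N" if "k < N" for k
    using that c_eq[of N k] c_eq[of N "Suc k"] by (cases "Suc k = N") (auto simp: cycle_edge_def j)
  have red: "redirect i j (?e k) = ?e' k" if "k < N" for k
  proof (cases "Suc k = N")
    case True
    then have "k = N - 1" by simp
    moreover have "c (N - 1) \<noteq> j" using c_eq[of "N - 1" N] assms(2) by (simp add: j)
    ultimately show ?thesis
      using that e[OF that] e'_last j_in[OF that] True by (auto simp: redirect_def)
  next
    case False
    then show ?thesis using that e[OF that] j_in[OF that] by (simp add: redirect_def)
  qed
  have edges': "edges ?I' = ?e' ` {..<N}"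
    by (simp add: eliminate_def Let_def R_def[symmetric] R image_image red cong: image_cong_simp)
  have weight': "weight ?I' (?e' k) = (\<Prod>v\<in>?e' k. z v)" if k: "k < N" for k
  proof -
    have "{e \<in> R. redirect i j e = ?e' k} = {?e k}"
    proof (intro equalityI subsetI)
      fix e assume "e \<in> {e \<in> R. redirect i j e = ?e' k}"
      then obtain l where l: "l < N" "e = ?e l" "redirect i j (?e l) = ?e' k" unfolding R by blast
      then have "l = k" using inj_onD[OF inj_e', of l k] red[of l] k by simp
      then show "e \<in> {?e k}" using l(2) by simp
    next
      fix e assume "e \<in> {?e k}"
      then show "e \<in> {e \<in> R. redirect i j e = ?e' k}" unfolding R using red[OF k] k by simp
    qed
    then have "weight ?I' (?e' k) = (if j \<in> ?e k then ?s else 1) * weight I (?e k)"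
      by (simp add: eliminate_def Let_def R_def[symmetric])
    also have "weight I (?e k) = (\<Prod>v\<in>?e k. z v)"
      using k by (intro weight) (simp add: edges)
    also have "(if j \<in> ?e k then ?s else 1) * (\<Prod>v\<in>?e k. z v) = (\<Prod>v\<in>?e' k. z v)"
    proof (cases "Suc k = N")
      case True
      then have "k = N - 1" by simp
      moreover have "c (N - 1) \<noteq> j" "c (N - 1) \<noteq> i"
        using c_eq[of "N - 1" N] c_eq[of "N - 1" 0] assms(2) by (auto simp: i j)
      moreover have "z j * z j = 1" using z_cases[of j] c_in_verts[of N] by (auto simp: j)
      ultimately show ?thesis
        using k e[OF k] e'_last j_in[OF k] True by (simp add: mult_ac)
    next
      case False
      then show ?thesis using k e[OF k] j_in[OF k] by simp
    qed
    finally show ?thesis .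
  qed
  have verts': "verts ?I' = c ` {..<N}"
    using c_eq by (auto simp: verts j lessThan_Suc)
  have "weight I {i, j} = ?s"
    using weight[OF assms(3)] edge_neq[OF assms(3)] by simp
  moreover have "?s * ?s = 1" using edge_sign[OF assms(3)] by auto
  ultimately have "const_term ?I' = const_term I + 1"
    by (simp add: eliminate_def Let_def)
  then have "const_term ?I' \<in> \<int>" using const_int by simp
  then have "unfrustrated_ring z c N ?I'"
    unfolding unfrustrated_ring_def
    using assms(2) inj_c' verts' edges' weight' z_cases by (auto simp: verts)
  then show ?thesis by blast
qed

text \<open>An elimination in a ring of three vertices leaves two, where edges merge and the ring
  form is lost; but then \<open>2 \<le> n\<^sub>c\<close> sends the run to brute force. The second
  alternative in the hypothesis carries this case through the induction.\<close>

lemma rqaoa1_ring_is_maximizer: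
  assumes "rqaoa1 n\<^sub>c I x" and "2 \<le> n\<^sub>c"
    and "(\<exists>c M. unfrustrated_ring z c M I) \<or> card (verts I) \<le> n\<^sub>c"
  shows "is_maximizer (verts I) (ising_ham I) x"
  using assms(1,3)
proof (induction rule: rqaoa1.induct)
  case (eliminate_step I b g i j s y x)
  then obtain c M where ring_c: "unfrustrated_ring z c M I" by auto
  interpret ring_instance z c M I by unfold_locales (fact ring_c)
  have s: "s = z i * z j"
    using sgn_correlation eliminate_step.hyps by simp
  have ij: "i \<in> verts I" "j \<in> verts I" using edge_in_verts eliminate_step.hyps by auto
  have "(\<exists>c M. unfrustrated_ring z c M (eliminate i j s I)) \<or> card (verts (eliminate i j s I)) \<le> n\<^sub>c"
  proof (cases "M = 3")
    case True
    then show ?thesis using \<open>2 \<le> n\<^sub>c\<close> ij finite_verts card_verts by simp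
  next
    case False
    then obtain N where N: "M = Suc N" "3 \<le> N" using M_ge by (cases M) auto
    from unfrustrated_ring_eliminate[OF ring_c[unfolded N(1)] N(2)] show ?thesis
      using eliminate_step.hyps unfolding s by blast
  qed
  then have y: "is_maximizer (verts (eliminate i j s I)) (ising_ham (eliminate i j s I)) y"
    by (rule eliminate_step.IH)
  show ?case
  proof (rule is_maximizer_eliminate[OF finite_verts finite_edges edge_subset])
    show "is_maximizer (verts (eliminate i j s I)) (ising_ham (eliminate i j s I)) (restrict x (verts I - {j}))"
      using y eliminate_step.hyps by simp
    show "s = 1 \<or> s = -1" unfolding s by (rule edge_sign) (fact \<open>{i, j} \<in> edges I\<close>)
    \<comment> \<open>The planted optimum obeys the imposed constraint, so the elimination does not
      lose it.\<close>
    have "z i * z i = 1" using z_cases[OF ij(1)] by auto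
    then show "spin x_opt j = s * spin x_opt i"
      by (simp add: spin_x_opt ij s mult_ac)
  qed (use eliminate_step.hyps x_opt_maximizer in auto)
qed

section \<open>Existence of RQAOA runs\<close>

lemma rqaoa1_bitstrings: "rqaoa1 n\<^sub>c I x \<Longrightarrow> x \<in> bitstrings (verts I)"
  by (erule rqaoa1.cases) (simp_all add: is_maximizer_def)

lemma rqaoa1_brute_force_exists:
  assumes "finite (verts I)" "card (verts I) \<le> n\<^sub>c"
  shows "\<exists>x. rqaoa1 n\<^sub>c I x"
proof -
  have "finite (ising_energy I ` bitstrings (verts I))" "ising_energy I ` bitstrings (verts I) \<noteq> {}"
    using assms(1) by simp_all
  then obtain x where "x \<in> bitstrings (verts I)" "ising_energy I x = Max (ising_energy I ` bitstrings (verts I))"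
    using Max_in by (metis (no_types, lifting) imageE)
  then have "is_maximizer (verts I) (ising_ham I) x"
    unfolding ising_ham_eq_diag_op is_maximizer_diag_op[OF assms(1)] using assms(1) by simp
  then show ?thesis using assms(2) rqaoa1.brute_force by blast
qed

text \<open>Keeps the correctness of all outputs from being vacuous. Optimal angles exist by
  integrality, every edge attains the largest correlation, and its sign is nonzero, so each step can
  be completed.\<close>

lemma rqaoa1_ring_exists:
  assumes "unfrustrated_ring z c M I" "2 \<le> n\<^sub>c"
  shows "\<exists>x. rqaoa1 n\<^sub>c I x"
  using assms(1)
proof (induction M arbitrary: c I)
  case 0
  then show ?case by (simp add: unfrustrated_ring_def)
next
  case (Suc N)
  interpret ring_instance z c "Suc N" I by unfold_locales (fact Suc.prems)
  show ?case
  proof (cases "Suc N \<le> n\<^sub>c")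
    case True
    then show ?thesis using rqaoa1_brute_force_exists[OF finite_verts] card_verts by simp
  next
    case False
    obtain b g where opt: "qaoa1_optimal I b g" using optimal_exists by blast
    define i j where "i = c 0" and "j = c (Suc 0 mod Suc N)"
    have ij: "{i, j} \<in> edges I" unfolding edges image_cycle_edge i_def j_def by auto
    let ?s = "z i * z j"
    have "\<exists>y. rqaoa1 n\<^sub>c (eliminate i j ?s I) y"
    proof (cases "3 \<le> N")
      case True
      then show ?thesis
        using unfrustrated_ring_eliminate[OF Suc.prems True ij] Suc.IH by blast
    next
      case False
      then have "card (verts (eliminate i j ?s I)) \<le> n\<^sub>c"
        using card_verts finite_verts edge_in_verts[OF ij] assms(2) by simp
      then show ?thesis using finite_verts by (intro rqaoa1_brute_force_exists) auto
    qed
    then obtain y where y: "rqaoa1 n\<^sub>c (eliminate i j ?s I) y" by blast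
    have "y \<in> bitstrings (verts I - {j})" using rqaoa1_bitstrings[OF y] by simp
    then obtain x where x: "x \<in> bitstrings (verts I)" "restrict x (verts I - {j}) = y" "spin x j = ?s * spin x i"
      using ex_bits_extension[of y "verts I" j i ?s] edge_in_verts[OF ij] edge_neq[OF ij] edge_sign[OF ij] by blast
    have "rqaoa1 n\<^sub>c I x"
    proof (rule rqaoa1.eliminate_step[OF _ opt edge_neq[OF ij] ij _ _ y x])
      show "n\<^sub>c < card (verts I)" using False card_verts by simp
      show "\<forall>k l. {k, l} \<in> edges I \<longrightarrow> \<bar>correlation I b g k l\<bar> \<le> \<bar>correlation I b g i j\<bar>"
        using abs_correlation_eq[OF opt ij] by simp
      show "?s = sgn (correlation I b g i j)" using sgn_correlation[OF opt ij] by simp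
    qed
    then show ?thesis by blast
  qed
qed

section \<open>The family of Hamiltonians\<close>

text \<open>The planted assignment \<open>planted A\<close> is free on the vertices congruent to 1 modulo 3 only,
  so that each free spin can be read off an incident edge.\<close>

definition planted :: "nat set \<Rightarrow> nat \<Rightarrow> real" where
  "planted A k = (if k \<in> A then -1 else 1)"

definition planted_weights :: "nat \<Rightarrow> nat set \<Rightarrow> nat \<Rightarrow> real" where
  "planted_weights n A = (\<lambda>k\<in>{..<n}. planted A k * planted A (Suc k mod n))"

definition free_vertices :: "nat \<Rightarrow> nat set" where
  "free_vertices n = {k. k < n \<and> k mod 3 = 1}"

definition read_off :: "nat \<Rightarrow> (nat \<Rightarrow> real) \<Rightarrow> nat bits" where
  "read_off n J = (\<lambda>v\<in>{..<n}. if v mod 3 = 1 \<and> J v = -1 then 1 else 0)"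

lemma card_free_vertices: "3 dvd n \<Longrightarrow> card (free_vertices n) = n div 3"
proof -
  assume "3 dvd n"
  then obtain m where n: "n = 3 * m" by (auto elim: dvdE)
  have "free_vertices n = (\<lambda>k. 3 * k + 1) ` {..<m}"
  proof (intro equalityI subsetI)
    fix k assume "k \<in> free_vertices n"
    then have "k < 3 * m" "k mod 3 = 1" by (auto simp: free_vertices_def n)
    then have "k = 3 * (k div 3) + 1" "k div 3 < m" by presburger+
    then show "k \<in> (\<lambda>k. 3 * k + 1) ` {..<m}" by blast
  qed (auto simp: free_vertices_def n mod_Suc)
  then show ?thesis by (simp add: card_image inj_on_def n)
qed

text \<open>Edge k leads from a free vertex to one congruent to 2 modulo 3, whose spin is fixed at
  1; as 3 divides n, residues survive the wrap-around.\<close>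

lemma planted_weights_free:
  assumes "3 dvd n" "A \<subseteq> free_vertices n" "k \<in> free_vertices n"
  shows "planted_weights n A k = planted A k"
proof -
  have k: "k < n" "k mod 3 = 1" using assms(3) by (auto simp: free_vertices_def)
  have "(Suc k mod n) mod 3 = Suc k mod 3" using assms(1) by (rule mod_mod_cancel)
  also have "\<dots> = 2" using k(2) by (simp add: mod_Suc)
  finally have "Suc k mod n \<notin> A" using assms(2) by (auto simp: free_vertices_def)
  then show ?thesis using k(1) by (simp add: planted_weights_def planted_def)
qed

text \<open>Couplings determine an assignment only up to a global flip; fixing all other spins at 1
  removes this ambiguity.\<close>

lemma inj_on_planted_weights:
  assumes "3 dvd n"
  shows "inj_on (planted_weights n) (Pow (free_vertices n))"
proof (rule inj_onI)
  fix A B assume A: "A \<in> Pow (free_vertices n)" and B: "B \<in> Pow (free_vertices n)"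
    and eq: "planted_weights n A = planted_weights n B"
  have "k \<in> A \<longleftrightarrow> k \<in> B" if "k \<in> free_vertices n" for k
  proof -
    have "planted A k = planted B k"
      using planted_weights_free[OF assms _ that, of A] planted_weights_free[OF assms _ that, of B] A B eq by simp
    then show ?thesis by (simp add: planted_def split: if_splits)
  qed
  then show "A = B" using A B by blast
qed

text \<open>Radius 1 suffices because edge v is itself a path of length 1 starting at v.\<close>

lemma local_algorithm_read_off:
  assumes "2 \<le> n"
  shows "local_algorithm n 1 (read_off n)"
  unfolding local_algorithm_def
proof (intro conjI ballI allI impI)
  fix J :: "nat \<Rightarrow> real"
  show "read_off n J \<in> bitstrings {..<n}" by (auto simp: read_off_def bitstrings_def)
next
  fix v assume v: "v < n"
  have "is_path (cycle_edge n ` {..<n}) [v, Suc v mod n]"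
    using v Suc_mod_neq[OF assms v] by (auto simp: is_path_def cycle_edge_def)
  then have "\<exists>vs i. is_path (cycle_edge n ` {..<n}) vs \<and> hd vs = v \<and> length vs \<le> Suc 1
      \<and> Suc i < length vs \<and> cycle_edge n v = {vs ! i, vs ! Suc i}"
    by (intro exI[of _ "[v, Suc v mod n]"] exI[of _ 0]) (simp add: cycle_edge_def)
  then have "v \<in> local_edges n 1 v"
    using v unfolding local_edges_def by blast
  then have "\<forall>J\<in>{..<n} \<rightarrow>\<^sub>E UNIV. read_off n J v =
      (if v mod 3 = 1 \<and> restrict J (local_edges n 1 v) v = -1 then 1 else 0)"
    using v by (simp add: read_off_def)
  then show "\<exists>g. \<forall>J\<in>{..<n} \<rightarrow>\<^sub>E UNIV. read_off n J v = g (restrict J (local_edges n 1 v))"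
    by (rule exI[of _ "\<lambda>r. if v mod 3 = 1 \<and> r v = -1 then 1 else 0"])
qed

section \<open>The planted cycle as a ring, and its QAOA ratio\<close>

lemma cycle_ising_unfrustrated:
  assumes n: "3 \<le> n" and J: "\<And>k. k < n \<Longrightarrow> J k = planted A k * planted A (Suc k mod n)"
  shows "unfrustrated_ring (planted A) (\<lambda>k. k) n (cycle_ising n J)"
proof -
  have "weight (cycle_ising n J) (cycle_edge n k) = (\<Prod>v\<in>cycle_edge n k. planted A v)" if k: "k < n" for k
  proof -
    have "{l. l < n \<and> cycle_edge n l = cycle_edge n k} = {k}"
      using inj_onD[OF inj_on_cycle_edge[OF n], of _ k] k by auto
    then show ?thesis
      using Suc_mod_neq[of n k] n k by (simp add: cycle_ising_def J cycle_edge_def[of n k])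
  qed
  then show ?thesis
    using n unfolding unfrustrated_ring_def
    by (auto simp: cycle_ising_def planted_def)
qed

text \<open>The cycle is itself a ring, so its n edges share the mean energy equally and the bound
  for edge p carries over to the total.\<close>

lemma cycle_qaoa_ratio_le:
  assumes p: "1 \<le> p" and n: "2 * p + 2 \<le> n" and J: "\<And>k. k < n \<Longrightarrow> J k = 1 \<or> J k = -1"
    and max: "max_value {..<n} (cycle_ham n J) = n"
  shows "qaoa_ratio {..<n} (cycle_ham n J) p \<le> real p / (real p + 1)"
proof -
  let ?c = "\<lambda>k::nat. k" and ?h = "ring_energy (\<lambda>k. k) n J"
  have "expval {..<n} (cycle_ham n J) (qaoa_state {..<n} (cycle_ham n J) p \<beta> \<gamma>) \<le> n * (real p / (real p + 1))" for \<beta> \<gamma>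
  proof -
    let ?mean = "qaoa_mean {..<n} ?h \<beta> \<gamma> [1..<Suc p]"
    have "expval {..<n} (cycle_ham n J) (qaoa_state {..<n} (cycle_ham n J) p \<beta> \<gamma>) = ?mean ?h"
      unfolding cycle_ham_eq_diag_op by (rule expval_qaoa_state) simp
    also have "\<dots> = real n * ?mean (ring_term ?c n J p)"
    proof (rule qaoa_mean_ring_term[symmetric])
      show "?h x = 0 + ?h x" for x by simp
      show "J k = 1 \<or> J k = -1" if "k < n" for k using that by (rule J)
    qed (use n in simp_all)
    also have "\<dots> \<le> real n * (real p / (real p + 1))"
    proof (rule mult_left_mono)
      show "?mean (ring_term ?c n J p) \<le> real p / (real p + 1)"
        by (rule qaoa_mean_cycle_edge_le[OF p n J]) simp_all
    qed simp
    finally show ?thesis .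
  qed
  then have "(SUP (\<beta>, \<gamma>). expval {..<n} (cycle_ham n J) (qaoa_state {..<n} (cycle_ham n J) p \<beta> \<gamma>))
      \<le> n * (real p / (real p + 1))"
    by (intro cSUP_least) (simp_all add: split_paired_all)
  then show ?thesis
    unfolding qaoa_ratio_def max using n by (subst pos_divide_le_eq) (simp_all add: mult.commute)
qed

theorem theorem3:
  shows "\<exists>r::nat. \<forall>n::nat. n > 0 \<and> 6 dvd n \<longrightarrow>
    (\<exists>(F :: (nat \<Rightarrow> real) set) (alg :: (nat \<Rightarrow> real) \<Rightarrow> nat bits).
       F \<subseteq> ({..<n} \<rightarrow>\<^sub>E {1, -1}) \<and> card F = 2 ^ (n div 3) \<and>
       local_algorithm n r alg \<and>
       (\<forall>J\<in>F.
          is_maximizer {..<n} (cycle_ham n J) (alg J) \<and>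
          (\<forall>p. 1 \<le> p \<and> 2 * p < n \<longrightarrow>
             qaoa_ratio {..<n} (cycle_ham n J) p \<le> real p / (real p + 1)) \<and>
          (\<forall>n\<^sub>c. 2 \<le> n\<^sub>c \<and> n\<^sub>c < n \<longrightarrow>
             (\<exists>x. rqaoa1 n\<^sub>c (cycle_ising n J) x) \<and>
             (\<forall>x. rqaoa1 n\<^sub>c (cycle_ising n J) x \<longrightarrow>
                is_maximizer {..<n} (cycle_ham n J) x))))"
proof (rule exI[of _ 1], intro allI impI)
  fix n :: nat
  assume "n > 0 \<and> 6 dvd n"
  then have "0 < n" "6 dvd n" by simp_all
  then obtain m where m: "n = 6 * m" "0 < m" by (auto elim: dvdE)
  then have n: "6 \<le> n" "3 dvd n" "2 dvd n" by simp_all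
  let ?F = "planted_weights n ` Pow (free_vertices n)"
  have "?F \<subseteq> {..<n} \<rightarrow>\<^sub>E {1, -1}"
    unfolding planted_weights_def planted_def by (intro image_subsetI restrict_PiE[THEN iffD2]) auto
  moreover have "card ?F = 2 ^ (n div 3)"
    using card_image[OF inj_on_planted_weights[OF n(2)]] card_free_vertices[OF n(2)]
    by (simp add: card_Pow free_vertices_def)
  moreover have "local_algorithm n 1 (read_off n)"
    using n by (intro local_algorithm_read_off) simp
  moreover have "is_maximizer {..<n} (cycle_ham n J) (read_off n J) \<and>
      (\<forall>p. 1 \<le> p \<and> 2 * p < n \<longrightarrow> qaoa_ratio {..<n} (cycle_ham n J) p \<le> real p / (real p + 1)) \<and>
      (\<forall>n\<^sub>c. 2 \<le> n\<^sub>c \<and> n\<^sub>c < n \<longrightarrow>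
         (\<exists>x. rqaoa1 n\<^sub>c (cycle_ising n J) x) \<and>
         (\<forall>x. rqaoa1 n\<^sub>c (cycle_ising n J) x \<longrightarrow> is_maximizer {..<n} (cycle_ham n J) x))"
    if "J \<in> ?F" for J
  proof -
    obtain A where A: "A \<subseteq> free_vertices n" and J_def: "J = planted_weights n A" using \<open>J \<in> ?F\<close> by blast
    have J: "J k = planted A k * planted A (Suc k mod n)" if "k < n" for k
      using that by (simp add: J_def planted_weights_def)
    have J_cases: "J k = 1 \<or> J k = -1" if "k < n" for k
      by (simp add: J[OF that] planted_def)
    have "3 \<le> n" "2 \<le> n" using n(1) by simp_all
    note ring = cycle_ising_unfrustrated[OF \<open>3 \<le> n\<close> J]
    interpret ring_instance "planted A" "\<lambda>k. k" n "cycle_ising n J"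
      by unfold_locales (rule ring)
    have ham: "ising_ham (cycle_ising n J) = cycle_ham n J"
      by (rule ising_ham_cycle_ising) fact
    have verts_n: "verts (cycle_ising n J) = {..<n}" by (simp add: cycle_ising_def)
    \<comment> \<open>The planted assignment is optimal, and each of its free spins equals the
      coupling of the edge with the same index.\<close>
    have "read_off n J = x_opt"
    proof
      fix v
      have "J v = planted A v" if "v \<in> free_vertices n"
        unfolding J_def by (rule planted_weights_free[OF n(2) A that])
      then show "read_off n J v = x_opt v"
        using A by (auto simp: read_off_def x_opt_def verts_n planted_def free_vertices_def)
    qed
    then have read_off_max: "is_maximizer {..<n} (cycle_ham n J) (read_off n J)"
      using x_opt_maximizer by (simp add: ham verts_n)
    \<comment> \<open>All n terms are 1 at the planted assignment, which gives the denominator of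
      the ratio.\<close>
    have "ring_energy (\<lambda>k. k) n J x_opt = ring_energy (\<lambda>k. k) n w x_opt"
      unfolding ring_energy_def ring_term_def by (rule sum.cong) (simp_all add: w_def J)
    also have "\<dots> = n" unfolding ring_energy_def by (simp add: ring_term_x_opt)
    finally have "max_value {..<n} (cycle_ham n J) = n"
      using read_off_max \<open>read_off n J = x_opt\<close> x_opt_bits expval_ket[of "{..<n}" x_opt]
      unfolding is_maximizer_def cycle_ham_eq_diag_op verts_n by simp
    then have "qaoa_ratio {..<n} (cycle_ham n J) p \<le> real p / (real p + 1)" if "1 \<le> p" "2 * p < n" for p
    proof (intro cycle_qaoa_ratio_le J_cases)
      \<comment> \<open>Evenness of n turns the strict bound into room for the frustrated
        ring.\<close>
      show "2 * p + 2 \<le> n" using that(2) n(3) by (auto elim!: dvdE)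
    qed (use that in auto)
    moreover have "\<exists>x. rqaoa1 n\<^sub>c (cycle_ising n J) x" if "2 \<le> n\<^sub>c" for n\<^sub>c
      by (rule rqaoa1_ring_exists[OF ring that])
    moreover have "is_maximizer {..<n} (cycle_ham n J) x" if "2 \<le> n\<^sub>c" "rqaoa1 n\<^sub>c (cycle_ising n J) x" for n\<^sub>c x
      using rqaoa1_ring_is_maximizer[OF that(2,1)] ring unfolding ham verts_n by blast
    ultimately show ?thesis using read_off_max by blast
  qed
  ultimately show "\<exists>(F :: (nat \<Rightarrow> real) set) (alg :: (nat \<Rightarrow> real) \<Rightarrow> nat bits).
       F \<subseteq> ({..<n} \<rightarrow>\<^sub>E {1, -1}) \<and> card F = 2 ^ (n div 3) \<and>
       local_algorithm n 1 alg \<and>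
       (\<forall>J\<in>F.
          is_maximizer {..<n} (cycle_ham n J) (alg J) \<and>
          (\<forall>p. 1 \<le> p \<and> 2 * p < n \<longrightarrow>
             qaoa_ratio {..<n} (cycle_ham n J) p \<le> real p / (real p + 1)) \<and>
          (\<forall>n\<^sub>c. 2 \<le> n\<^sub>c \<and> n\<^sub>c < n \<longrightarrow>
             (\<exists>x. rqaoa1 n\<^sub>c (cycle_ising n J) x) \<and>
             (\<forall>x. rqaoa1 n\<^sub>c (cycle_ising n J) x \<longrightarrow>
                is_maximizer {..<n} (cycle_ham n J) x)))"
    by (intro exI[of _ ?F] exI[of _ "read_off n"]) blast
qed

end
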